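(* Let $F\subset\mathbb{R}^p$ be compact. Then the function $\alpha\mapsto D_*(\alpha,F)$ is monotone increasing (i.e. non-decreasing) on $(0,1]$: if $0<\alpha\le\alpha'\le 1$, then $D_*(\alpha,F)\le D_*(\alpha',F)$.
   Context: For $0<\alpha\le 1$, a function $f:F\to\mathbb{R}$ is $1$-Hölder-$\alpha$ if $|f(x)-f(y)|\le |x-y|^\alpha$ for all $x,y\in F$. $C_1^\alpha(F)$ denotes the set of all $1$-Hölder-$\alpha$ functions on $F$, equipped with the metric of the supremum norm. $\lambda$ is one-dimensional Lebesgue measure and $\dim_H$ is Hausdorff dimension (with $\dim_H\emptyset=\inf\{s\ge 0:\mathcal H^s(\emptyset)=0\}=0$). For $f:F\to\mathbb{R}$ and $r\in\mathbb{R}$ put $D^f(r,F)=\dim_H(f^{-1}(r))$ and $$D_*^f(F)=\sup\{d:\lambda\{r: D^f(r,F)\ge d\}>0\}.$$ Let $\mathfrak{G}_{1,\alpha}(F)$ be the family of all dense $G_\delta$ subsets of $C_1^\alpha(F)$, and set $$D_*(\alpha,F)=\sup_{\mathcal{G}\in\mathfrak{G}_{1,\alpha}(F)}\inf\{D_*^f(F): f\in\mathcal{G}\}.$$ *)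

theory Defs
  imports "HOL-Analysis.Analysis"
begin

text \<open>
  The explicit cases give \<open>0 ^ 0 = 1\<close> for nonempty sets of diameter 0 (so that the
  0-dimensional Hausdorff measure is the counting measure), whereas \<open>0 powr 0 = 0\<close>.
\<close>
definition hausdorff_gauge :: "real \<Rightarrow> 'a::metric_space set \<Rightarrow> ennreal" where
  "hausdorff_gauge s U =
     (if U = {} then 0 else if s = 0 then 1 else ennreal (diameter U powr s))"

text \<open>
  Finite covers are included, since members of the sequence may be empty. Boundedness is
  required because \<^const>\<open>diameter\<close> has no meaningful value on unbounded sets.
\<close>
definition hausdorff_premeasure :: "real \<Rightarrow> real \<Rightarrow> 'a::metric_space set \<Rightarrow> ennreal" where
  "hausdorff_premeasure s \<delta> A =
     Inf {\<Sum>i. hausdorff_gauge s (U i) | U :: nat \<Rightarrow> 'a set.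
            A \<subseteq> (\<Union>i. U i) \<and> (\<forall>i. bounded (U i) \<and> diameter (U i) \<le> \<delta>)}"

definition hausdorff_measure :: "real \<Rightarrow> 'a::metric_space set \<Rightarrow> ennreal" where
  "hausdorff_measure s A = (SUP \<delta>\<in>{0<..}. hausdorff_premeasure s \<delta> A)"

definition hausdorff_dim :: "'a::metric_space set \<Rightarrow> ennreal" where
  "hausdorff_dim A = Inf {ennreal s | s. 0 \<le> s \<and> hausdorff_measure s A = 0}"

definition holder1_on :: "real \<Rightarrow> 'a::metric_space set \<Rightarrow> ('a \<Rightarrow> real) \<Rightarrow> bool" where
  "holder1_on \<alpha> F f \<longleftrightarrow> (\<forall>x\<in>F. \<forall>y\<in>F. \<bar>f x - f y\<bar> \<le> dist x y powr \<alpha>)"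

text \<open>
  Functions on \<open>F\<close> are represented as extensional functions. The elements of
  \<^const>\<open>funspace\<close> are moreover bounded on \<open>F\<close>, which is automatic for compact \<open>F\<close>
  (see \<open>mspace_holder_space\<close> below); its metric is the supremum metric.
\<close>
definition holder_space :: "real \<Rightarrow> 'a::metric_space set \<Rightarrow> ('a \<Rightarrow> real) metric" where
  "holder_space \<alpha> F = submetric (funspace F euclidean_metric) {f. holder1_on \<alpha> F f}"

definition level_dim :: "('a::metric_space \<Rightarrow> real) \<Rightarrow> real \<Rightarrow> 'a set \<Rightarrow> ennreal" where
  "level_dim f r F = hausdorff_dim {x \<in> F. f x = r}"

definition D_star_fun :: "('a::metric_space \<Rightarrow> real) \<Rightarrow> 'a set \<Rightarrow> ennreal" where
  "D_star_fun f F = Sup {d. emeasure lebesgue {r. level_dim f r F \<ge> d} > 0}"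

definition dense_gdeltas :: "real \<Rightarrow> 'a::metric_space set \<Rightarrow> ('a \<Rightarrow> real) set set" where
  "dense_gdeltas \<alpha> F =
     {G. gdelta_in (mtopology_of (holder_space \<alpha> F)) G \<and>
         mtopology_of (holder_space \<alpha> F) closure_of G = mspace (holder_space \<alpha> F)}"

definition D_star :: "real \<Rightarrow> 'a::metric_space set \<Rightarrow> ennreal" where
  "D_star \<alpha> F = (SUP G\<in>dense_gdeltas \<alpha> F. INF f\<in>G. D_star_fun f F)"

lemma mspace_holder_space:
  fixes F :: "'a::metric_space set"
  assumes "compact F" "0 \<le> \<alpha>"
  shows "mspace (holder_space \<alpha> F) = {f \<in> extensional F. holder1_on \<alpha> F f}"
proof -
  have "bounded (f ` F)" if f: "holder1_on \<alpha> F f" for f :: "'a \<Rightarrow> real"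
  proof (cases "F = {}")
    case False
    then obtain a where a: "a \<in> F" by blast
    have "dist (f a) (f x) \<le> diameter F powr \<alpha>" if x: "x \<in> F" for x
    proof -
      have "dist a x powr \<alpha> \<le> diameter F powr \<alpha>"
        using assms a x by (simp add: powr_mono2 compact_imp_bounded diameter_bounded_bound)
      then show ?thesis
        using f a x unfolding holder1_on_def dist_real_def by force
    qed
    then show ?thesis by (auto simp: bounded_def)
  qed simp
  then show ?thesis
    by (auto simp: holder_space_def Met_TC.fspace_def)
qed

lemma mdist_holder_space:
  assumes "f \<in> mspace (holder_space \<alpha> F)" "g \<in> mspace (holder_space \<alpha> F)" "F \<noteq> {}"
  shows "mdist (holder_space \<alpha> F) f g = (SUP x\<in>F. \<bar>f x - g x\<bar>)"
  using assms by (simp add: holder_space_def Met_TC.fdist_def dist_real_def)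

lemma hausdorff_dim_empty: "hausdorff_dim ({} :: 'a::metric_space set) = 0"
proof -
  have "hausdorff_premeasure 0 \<delta> ({} :: 'a set) = 0" if "\<delta> > 0" for \<delta>
  proof -
    have "hausdorff_premeasure 0 \<delta> ({} :: 'a set) \<le> (\<Sum>i. hausdorff_gauge 0 ((\<lambda>_::nat. {} :: 'a set) i))"
      unfolding hausdorff_premeasure_def using that by (intro Inf_lower CollectI exI[of _ "\<lambda>_. {}"]) auto
    then show ?thesis by (simp add: hausdorff_gauge_def)
  qed
  then have "hausdorff_measure 0 ({} :: 'a set) = 0"
    by (simp add: hausdorff_measure_def)
  then have "hausdorff_dim ({} :: 'a set) \<le> ennreal 0"
    unfolding hausdorff_dim_def by (intro Inf_lower) blast
  then show ?thesis by simp
qed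

end

theory Submission
  imports Defs
begin

text \<open>
  Fix \<open>0 < \<alpha> < \<beta> \<le> 1\<close> and \<open>s > 0\<close> below the value at \<open>\<alpha>\<close>. It suffices to find, near every
  1-Hoelder-\<open>\<beta>\<close> function \<open>g\<close>, a ball of 1-Hoelder-\<open>\<beta>\<close> functions whose level sets have dimension at
  least \<open>s\<close> for a set of levels of positive measure: the union of such open balls is a dense open
  set, which is the required dense \<open>G\<^sub>\<delta>\<close>.

  The difficulty is that 1-Hoelder-\<open>\<beta>\<close> functions are a negligible part of the 1-Hoelder-\<open>\<alpha>\<close>
  functions (up to a factor), so a generic property of the latter says nothing about them
  directly. The way out is that the property in question is, up to countable unions, closed.
  On a compact set, having \<open>s\<close>-dimensional content at least \<open>c\<close> can be tested on finite open
  covers, and such a cover of a level set also covers all level sets of uniformly close functions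
  at close levels. Hence the set of levels with large content depends upper semicontinuously on
  the function (\<open>emeasure_large_levels_upper_semicontinuous\<close>), and by Baire's theorem the property
  holds on a whole ball of the 1-Hoelder-\<open>\<alpha>\<close> functions, around some \<open>f\<^sub>0\<close>. Moreover, if \<open>F\<close> is cut
  into finitely many compact pieces beforehand, then one piece \<open>Q\<close> is responsible for the large
  level sets of every member of the ball (\<open>generic_large_levels_locally_persistent\<close>).

  The pieces used are the sets where \<open>g\<close> is within \<open>\<tau>\<close> of a constant \<open>j\<close>. Soft thresholding around
  \<open>j\<close> turns \<open>g\<close> into a 1-Hoelder-\<open>\<beta>\<close> function that is constant on \<open>Q\<close>. The centre \<open>f\<^sub>0\<close> is replaced by a
  nearby \<open>f\<^sub>1\<close> that is Hoelder-\<open>\<alpha>\<close> with a constant below 1 and Hoelder-\<open>\<beta>\<close> with some constant. Add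
  \<open>\<kappa> f\<^sub>1\<close> with a small \<open>\<kappa>\<close> to the flattened (and slightly shrunk) \<open>g\<close>, and let \<open>h\<close> be any
  1-Hoelder-\<open>\<beta>\<close> function very close to the result. On \<open>Q\<close> the function \<open>h\<close> is, up to an affine
  change of the range, a function \<open>w\<close> close to \<open>f\<^sub>1\<close>. This \<open>w\<close> is Hoelder-\<open>\<beta>\<close> with the large constant
  \<open>1 / \<kappa>\<close>, but \<open>\<alpha> < \<beta>\<close> makes it 1-Hoelder-\<open>\<alpha>\<close> at small distances, and truncating it to a thin tube
  around \<open>f\<^sub>1\<close>, which leaves it unchanged on \<open>Q\<close>, makes it 1-Hoelder-\<open>\<alpha>\<close> at all distances
  (\<open>clamped_function_holder\<close>). The truncated function lies in the ball provided by Baire's theorem,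
  and its large level sets in \<open>Q\<close> are level sets of \<open>h\<close>.
\<close>

section \<open>Content of compact sets by finite open covers\<close>

text \<open>
  A lower bound for the \<open>s\<close>-dimensional Hausdorff content. Restricting it to finite families of open
  sets loses nothing for compact sets, makes the bound stable under small perturbations of the set,
  and keeps all sums finite and real. The diameters are not bounded, because sets of dimension at
  least \<open>s\<close> are recognised already without such a bound.
\<close>
definition content_ge :: "real \<Rightarrow> real \<Rightarrow> 'a::metric_space set \<Rightarrow> bool" where
  "content_ge s c A \<longleftrightarrow>
     (\<forall>\<U>. finite \<U> \<and> (\<forall>U\<in>\<U>. open U \<and> bounded U) \<and> A \<subseteq> \<Union>\<U> \<longrightarrow> c \<le> (\<Sum>U\<in>\<U>. diameter U powr s))"

lemma not_content_geI:
  assumes "finite \<U>" "\<And>U. U \<in> \<U> \<Longrightarrow> open U" "\<And>U. U \<in> \<U> \<Longrightarrow> bounded U" "A \<subseteq> \<Union>\<U>"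
    and "(\<Sum>U\<in>\<U>. diameter U powr s) < c"
  shows "\<not> content_ge s c A"
  using assms unfolding content_ge_def not_le[symmetric] by blast

lemma not_content_geE:
  assumes "\<not> content_ge s c A"
  obtains \<U> where "finite \<U>" "\<And>U. U \<in> \<U> \<Longrightarrow> open U" "\<And>U. U \<in> \<U> \<Longrightarrow> bounded U" "A \<subseteq> \<Union>\<U>"
    "(\<Sum>U\<in>\<U>. diameter U powr s) < c"
  using assms unfolding content_ge_def not_le[symmetric] by blast

lemma content_ge_mono:
  assumes "content_ge s c A" "A \<subseteq> B" "d \<le> c"
  shows "content_ge s d B"
  using assms unfolding content_ge_def by (meson order_trans)

lemma content_ge_nonempty:
  assumes "content_ge s c A" "c > 0"
  shows "A \<noteq> {}"
  using assms not_content_geI[of "{}" "{}" s c] by auto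

lemma not_content_ge_Un:
  assumes A: "\<And>c. c > 0 \<Longrightarrow> \<not> content_ge s c A" and B: "\<And>c. c > 0 \<Longrightarrow> \<not> content_ge s c B"
    and "c > 0"
  shows "\<not> content_ge s c (A \<union> B)"
proof -
  have "c / 2 > 0" using \<open>c > 0\<close> by simp
  obtain \<U> where U: "finite \<U>" "\<And>U. U \<in> \<U> \<Longrightarrow> open U" "\<And>U. U \<in> \<U> \<Longrightarrow> bounded U" "A \<subseteq> \<Union>\<U>"
      "(\<Sum>U\<in>\<U>. diameter U powr s) < c / 2"
    using not_content_geE[OF A[OF \<open>c / 2 > 0\<close>]] by metis
  obtain \<V> where V: "finite \<V>" "\<And>U. U \<in> \<V> \<Longrightarrow> open U" "\<And>U. U \<in> \<V> \<Longrightarrow> bounded U" "B \<subseteq> \<Union>\<V>"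
      "(\<Sum>U\<in>\<V>. diameter U powr s) < c / 2"
    using not_content_geE[OF B[OF \<open>c / 2 > 0\<close>]] by metis
  show ?thesis
  proof (rule not_content_geI[of "\<U> \<union> \<V>"])
    have "(\<Sum>U\<in>\<U> \<union> \<V>. diameter U powr s)
        \<le> (\<Sum>U\<in>\<U>. diameter U powr s) + (\<Sum>U\<in>\<V>. diameter U powr s)"
      using U(1) V(1) by (simp add: sum_Un sum_nonneg)
    with U(5) V(5) show "(\<Sum>U\<in>\<U> \<union> \<V>. diameter U powr s) < c"
      by linarith
  qed (use U V in auto)
qed

lemma content_ge_finite_UN:
  assumes "finite J" "content_ge s c (\<Union>j\<in>J. A j)" "c > 0"
  shows "\<exists>j\<in>J. \<exists>d>0. content_ge s d (A j)"
proof (rule ccontr)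
  assume "\<not> ?thesis"
  then have null: "\<not> content_ge s d (A j)" if "j \<in> J" "d > 0" for j d
    using that by auto
  have "\<not> content_ge s c (\<Union>j\<in>J. A j)" if "c > 0" for c
    using \<open>finite J\<close> null that
  proof (induction J arbitrary: c)
    case empty
    then show ?case using content_ge_nonempty[of s c "{}"] by auto
  next
    case (insert j J)
    show ?case
      unfolding UN_insert
    proof (rule not_content_ge_Un)
      show "\<not> content_ge s d (A j)" if "d > 0" for d
        using insert.prems(1) that by simp
      show "\<not> content_ge s d (\<Union>j\<in>J. A j)" if "d > 0" for d
        by (rule insert.IH) (use insert.prems(1) that in auto)
    qed fact
  qed
  from this[OF \<open>c > 0\<close>] assms(2) show False by contradiction
qed

text \<open>
  Passing to a thin neighbourhood turns an arbitrary cover into an open one; for \<open>t > 0\<close> the function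
  \<open>x powr t\<close> is continuous from the right, also at 0, so the cost is arbitrarily small.
\<close>
lemma open_superset_diameter_powr:
  fixes U :: "'a::metric_space set"
  assumes "bounded U" "t > 0" "e > 0"
  obtains V where "open V" "bounded V" "U \<subseteq> V" "diameter V powr t \<le> diameter U powr t + e"
proof (cases "U = {}")
  case True
  then show ?thesis using that[of "{}"] assms by simp
next
  case False
  have "((\<lambda>r. (diameter U + 2 * r) powr t) \<longlongrightarrow> (diameter U + 2 * 0) powr t) (at_right 0)"
    using \<open>t > 0\<close> \<open>bounded U\<close>
    by (intro tendsto_intros) (auto simp: eventually_at_right_less diameter_ge_0 intro!: eventually_at_rightI[of 0 1])
  then have "eventually (\<lambda>r. (diameter U + 2 * r) powr t < diameter U powr t + e) (at_right 0)"
    using \<open>e > 0\<close> by (intro order_tendstoD) auto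
  then obtain r where r: "r > 0" "(diameter U + 2 * r) powr t < diameter U powr t + e"
    by (metis (no_types, lifting) dense eventually_at_right_field)
  define V where "V = (\<Union>x\<in>U. ball x r)"
  have dist: "dist x y \<le> diameter U + 2 * r" if xy: "x \<in> V" "y \<in> V" for x y
  proof -
    obtain a b where "a \<in> U" "b \<in> U" "dist a x < r" "dist b y < r"
      using xy by (auto simp: V_def)
    moreover have "dist a b \<le> diameter U"
      using \<open>bounded U\<close> \<open>a \<in> U\<close> \<open>b \<in> U\<close> by (rule diameter_bounded_bound)
    moreover have "dist x y \<le> dist a x + dist a b + dist b y"
      by (metis add.commute add_left_mono dist_commute dist_triangle dist_triangle_le)
    ultimately show ?thesis by linarith
  qed
  have "V \<noteq> {}" using False \<open>r > 0\<close> by (auto simp: V_def)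
  then have "diameter V \<le> diameter U + 2 * r"
    using dist unfolding diameter_def[of V] by (auto intro!: cSUP_least)
  moreover have "bounded V"
    using dist unfolding bounded_def by blast
  ultimately show ?thesis
    using r \<open>t > 0\<close>
    by (intro that[of V])
      (auto simp: V_def diameter_ge_0 intro!: powr_mono2 order_trans[OF powr_mono2 less_imp_le[OF r(2)]])
qed

text \<open>
  For sets of diameter at most 1, the gauge of the smaller exponent \<open>u\<close> dominates that of \<open>t\<close>, with
  \<open>u = 0\<close> included. The strict inequality ensures \<open>t > 0\<close>, as needed for making a cover open.
\<close>
lemma hausdorff_measure_0_imp_content_null:
  fixes A :: "'a::metric_space set"
  assumes "compact A" "hausdorff_measure u A = 0" "0 \<le> u" "u < t" "c > 0"
  shows "\<not> content_ge t c A"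
proof -
  have "hausdorff_premeasure u 1 A \<le> hausdorff_measure u A"
    unfolding hausdorff_measure_def by (rule SUP_upper) simp
  then have "hausdorff_premeasure u 1 A < ennreal (c / 2)"
    using assms by simp
  then obtain U where U: "A \<subseteq> (\<Union>i. U i)" "\<And>i. bounded (U i)" "\<And>i. diameter (U i) \<le> 1"
      and sum_U: "(\<Sum>i. hausdorff_gauge u (U i)) < ennreal (c / 2)"
    unfolding hausdorff_premeasure_def Inf_less_iff by auto
  \<comment> \<open>Half of \<open>c\<close> is spent on the cover, the other half, in summable portions, on making it open.\<close>
  define e where "e i = c / 2 * (1/2) ^ Suc i" for i :: nat
  have "e i > 0" for i using \<open>c > 0\<close> by (simp add: e_def)
  then have "\<exists>V. open V \<and> bounded V \<and> U i \<subseteq> V \<and> diameter V powr t \<le> diameter (U i) powr t + e i" for i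
    using open_superset_diameter_powr[of "U i" t "e i"] U(2) assms by (metis le_less_trans)
  then obtain V where V: "\<And>i. open (V i)" "\<And>i. bounded (V i)" "\<And>i. U i \<subseteq> V i"
      "\<And>i. diameter (V i) powr t \<le> diameter (U i) powr t + e i"
    by metis
  have "A \<subseteq> (\<Union>i. V i)" using U(1) V(3) by blast
  then obtain I where I: "finite I" "A \<subseteq> (\<Union>i\<in>I. V i)"
    using compactE_image[OF \<open>compact A\<close>, of UNIV V] V(1) by auto
  have gauge: "ennreal (diameter (U i) powr t) \<le> hausdorff_gauge u (U i)" for i
  proof (cases "U i = {} \<or> u = 0")
    case True
    have "diameter (U i) powr t \<le> 1 powr t"
      using U assms by (intro powr_mono2) (auto simp: diameter_ge_0)
    with True show ?thesis
      using assms by (auto simp: hausdorff_gauge_def ennreal_le_1)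
  next
    case False
    then show ?thesis
      using U assms by (auto simp: hausdorff_gauge_def diameter_ge_0 intro!: ennreal_leI powr_mono')
  qed
  have "ennreal (\<Sum>i\<in>I. diameter (U i) powr t) \<le> (\<Sum>i\<in>I. hausdorff_gauge u (U i))"
    using gauge by (simp add: sum_mono flip: sum_ennreal)
  also have "\<dots> \<le> (\<Sum>i. hausdorff_gauge u (U i))"
    using I by (intro sum_le_suminf) auto
  finally have "(\<Sum>i\<in>I. diameter (U i) powr t) < c / 2"
    using sum_U \<open>c > 0\<close> by (meson ennreal_less_iff le_less_trans sum_nonneg powr_ge_zero)
  moreover have "(\<Sum>i\<in>I. e i) \<le> c / 2"
  proof -
    have "e sums (c / 2 * 1)"
      unfolding e_def by (intro sums_mult power_half_series)
    then show ?thesis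
      using sum_le_suminf[of e I] I(1) \<open>\<And>i. e i > 0\<close> by (force simp: sums_iff less_imp_le)
  qed
  moreover have "(\<Sum>W\<in>V ` I. diameter W powr t) \<le> (\<Sum>i\<in>I. diameter (V i) powr t)"
    using sum_image_le[OF I(1), of "\<lambda>W. diameter W powr t" V] by (simp add: o_def)
  moreover have "(\<Sum>i\<in>I. diameter (V i) powr t) \<le> (\<Sum>i\<in>I. diameter (U i) powr t) + (\<Sum>i\<in>I. e i)"
    unfolding sum.distrib[symmetric] by (intro sum_mono V(4))
  ultimately have "(\<Sum>W\<in>V ` I. diameter W powr t) < c" by linarith
  then show ?thesis
    using I V by (intro not_content_geI[of "V ` I"]) auto
qed

text \<open>
  A cover with a small sum of \<open>t\<close>-th powers automatically consists of sets of small diameter, as \<open>t > 0\<close>.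
  So the cheap covers are admissible for every scale \<open>\<delta>\<close>.
\<close>
lemma content_null_imp_hausdorff_measure_0:
  fixes A :: "'a::metric_space set"
  assumes "t > 0" and null: "\<And>c. c > 0 \<Longrightarrow> \<not> content_ge t c A"
  shows "hausdorff_measure t A = 0"
proof -
  have "hausdorff_premeasure t \<delta> A \<le> ennreal e" if "\<delta> > 0" "e > 0" for \<delta> e :: real
  proof -
    have "min e (\<delta> powr t) > 0" using that by simp
    then obtain \<U> where \<U>: "finite \<U>" "\<And>U. U \<in> \<U> \<Longrightarrow> bounded U" "A \<subseteq> \<Union>\<U>"
        "(\<Sum>U\<in>\<U>. diameter U powr t) < min e (\<delta> powr t)"
      using not_content_geE[OF null] by metis
    have diam: "diameter U \<le> \<delta>" if "U \<in> \<U>" for U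
    proof -
      have "diameter U powr t \<le> (\<Sum>U\<in>\<U>. diameter U powr t)"
        using \<U>(1) that by (intro member_le_sum) auto
      then have "diameter U powr t < \<delta> powr t"
        using \<U>(4) by linarith
      then show ?thesis
        using \<open>t > 0\<close> \<open>\<delta> > 0\<close> by (meson less_imp_le not_le powr_mono2)
    qed
    obtain h where h: "bij_betw h {0..<card \<U>} \<U>"
      using ex_bij_betw_nat_finite[OF \<U>(1)] by blast
    define U where "U i = (if i < card \<U> then h i else {})" for i
    have hU: "h i \<in> \<U>" if "i < card \<U>" for i
      using h that by (auto simp: bij_betw_def)
    have "A \<subseteq> (\<Union>i. U i)"
    proof
      fix x assume "x \<in> A"
      then obtain W where "W \<in> \<U>" "x \<in> W" using \<U>(3) by blast
      then obtain i where "i < card \<U>" "h i = W"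
        using h by (metis atLeastLessThan_iff bij_betw_def image_iff)
      with \<open>x \<in> W\<close> show "x \<in> (\<Union>i. U i)" by (auto simp: U_def intro!: exI[of _ i])
    qed
    then have "hausdorff_premeasure t \<delta> A \<le> (\<Sum>i. hausdorff_gauge t (U i))"
      unfolding hausdorff_premeasure_def using diam hU \<U>(2) \<open>\<delta> > 0\<close>
      by (intro Inf_lower CollectI exI[of _ U]) (auto simp: U_def)
    also have "\<dots> = (\<Sum>i\<in>{0..<card \<U>}. hausdorff_gauge t (U i))"
      by (intro suminf_finite) (auto simp: U_def hausdorff_gauge_def)
    also have "\<dots> \<le> (\<Sum>i\<in>{0..<card \<U>}. ennreal (diameter (h i) powr t))"
      using \<open>t > 0\<close> by (intro sum_mono) (auto simp: U_def hausdorff_gauge_def)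
    also have "\<dots> = ennreal (\<Sum>U\<in>\<U>. diameter U powr t)"
      by (simp add: sum.reindex_bij_betw[OF h, of "\<lambda>U. diameter U powr t"])
    also have "\<dots> \<le> ennreal e"
      using \<U>(4) by (intro ennreal_leI) simp
    finally show ?thesis .
  qed
  then have "hausdorff_premeasure t \<delta> A = 0" if "\<delta> > 0" for \<delta>
    using ennreal_le_epsilon[of 0 "hausdorff_premeasure t \<delta> A"] that by simp
  then show ?thesis
    unfolding hausdorff_measure_def by simp
qed

section \<open>Hausdorff dimension in terms of content\<close>

lemma content_ge_imp_hausdorff_dim_ge:
  fixes A :: "'a::metric_space set"
  assumes "compact A" "content_ge s c A" "c > 0"
  shows "ennreal s \<le> hausdorff_dim A"
  unfolding hausdorff_dim_def
proof (rule Inf_greatest, clarify)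
  fix u :: real
  assume "0 \<le> u" "hausdorff_measure u A = 0"
  then have "\<not> u < s"
    using hausdorff_measure_0_imp_content_null[of A u s c] assms by blast
  then show "ennreal s \<le> ennreal u"
    by (intro ennreal_leI) simp
qed

lemma hausdorff_dim_gt_imp_content_ge:
  fixes A :: "'a::metric_space set"
  assumes "ennreal s < hausdorff_dim A" "s > 0"
  shows "\<exists>c>0. content_ge s c A"
proof (rule ccontr)
  assume "\<not> ?thesis"
  then have "hausdorff_measure s A = 0"
    using content_null_imp_hausdorff_measure_0[OF \<open>s > 0\<close>] by blast
  then have "hausdorff_dim A \<le> ennreal s"
    unfolding hausdorff_dim_def using \<open>s > 0\<close> by (intro Inf_lower) auto
  with assms show False by simp
qed

text \<open>
  The rational exponents and the bounds \<open>1 / Suc n\<close> make the condition a countable combination of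
  content bounds; this is how the measurability of sets of levels is obtained.
\<close>
lemma hausdorff_dim_ge_iff_content:
  fixes A :: "'a::metric_space set"
  assumes "compact A"
  shows "ennreal s \<le> hausdorff_dim A \<longleftrightarrow>
         (\<forall>t\<in>\<rat> \<inter> {0<..<s}. \<exists>n. content_ge t (1 / Suc n) A)"
proof
  assume s: "ennreal s \<le> hausdorff_dim A"
  show "\<forall>t\<in>\<rat> \<inter> {0<..<s}. \<exists>n. content_ge t (1 / Suc n) A"
  proof
    fix t assume t: "t \<in> \<rat> \<inter> {0<..<s}"
    then have "ennreal t < ennreal s"
      by (simp add: ennreal_lessI)
    with s t obtain c where "c > 0" "content_ge t c A"
      using hausdorff_dim_gt_imp_content_ge[of t A] order_less_le_trans by auto
    moreover obtain n where "1 / Suc n < c"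
      using \<open>c > 0\<close> by (rule nat_approx_posE)
    ultimately have "content_ge t (1 / Suc n) A"
      using content_ge_mono[of t c A A "1 / Suc n"] by simp
    then show "\<exists>n. content_ge t (1 / Suc n) A" ..
  qed
next
  assume R: "\<forall>t\<in>\<rat> \<inter> {0<..<s}. \<exists>n. content_ge t (1 / Suc n) A"
  show "ennreal s \<le> hausdorff_dim A"
  proof (rule ccontr)
    assume "\<not> ?thesis"
    then obtain u where u: "0 \<le> u" "hausdorff_measure u A = 0" "ennreal u < ennreal s"
      unfolding hausdorff_dim_def not_le Inf_less_iff by blast
    then have "u < s" by (simp add: ennreal_less_iff)
    then obtain t where t: "t \<in> \<rat>" "u < t" "t < s"
      using Rats_dense_in_real by blast
    with u R obtain n where "content_ge t (1 / Suc n) A" by fastforce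
    then show False
      using hausdorff_measure_0_imp_content_null[of A u t "1 / Suc n"] u t assms by simp
  qed
qed

section \<open>Levels with large level sets\<close>

lemma compact_in_sets_lebesgue: "compact S \<Longrightarrow> S \<in> sets (lebesgue :: real measure)"
  by (simp add: lmeasurable_compact fmeasurableD)

definition large_levels :: "real \<Rightarrow> real \<Rightarrow> ('a::metric_space \<Rightarrow> real) \<Rightarrow> 'a set \<Rightarrow> real set" where
  "large_levels s c f Q = {r. content_ge s c {x \<in> Q. f x = r}}"

lemma large_levels_mono:
  assumes "Q \<subseteq> R" "d \<le> c"
  shows "large_levels s c f Q \<subseteq> large_levels s d f R"
  using assms unfolding large_levels_def
  by (auto intro: content_ge_mono[of s c _ _ d])

lemma large_levels_subset_image: "c > 0 \<Longrightarrow> large_levels s c f Q \<subseteq> f ` Q"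
  unfolding large_levels_def using content_ge_nonempty by fastforce

lemma compact_level_set:
  fixes f :: "'a::metric_space \<Rightarrow> real"
  assumes "compact Q" "continuous_on Q f"
  shows "compact {x \<in> Q. f x = r}"
proof -
  have "closed (Q \<inter> f -` {r})"
    using assms by (intro continuous_closed_preimage) (auto simp: compact_imp_closed)
  then have "compact (Q \<inter> (Q \<inter> f -` {r}))"
    using assms(1) by (rule compact_Int_closed[rotated])
  moreover have "Q \<inter> (Q \<inter> f -` {r}) = {x \<in> Q. f x = r}" by auto
  ultimately show ?thesis by simp
qed

text \<open>
  A finite open cover of the level set of \<open>f\<close> leaves a compact rest of \<open>Q\<close>, on which \<open>f\<close> stays away from
  \<open>r\<close>. The same cover therefore serves all nearby functions and levels.
\<close>
lemma small_level_stable: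
  fixes f :: "'a::metric_space \<Rightarrow> real"
  assumes "compact Q" "continuous_on Q f" "r \<notin> large_levels s c f Q"
  obtains \<eta> where "\<eta> > 0"
    "\<And>g r'. (\<And>x. x \<in> Q \<Longrightarrow> \<bar>g x - f x\<bar> < \<eta>) \<Longrightarrow> \<bar>r' - r\<bar> < \<eta> \<Longrightarrow> r' \<notin> large_levels s c g Q"
proof -
  have "\<not> content_ge s c {x \<in> Q. f x = r}"
    using assms by (simp add: large_levels_def)
  then obtain \<U> where \<U>: "finite \<U>" "\<And>U. U \<in> \<U> \<Longrightarrow> open U" "\<And>U. U \<in> \<U> \<Longrightarrow> bounded U"
      "{x \<in> Q. f x = r} \<subseteq> \<Union>\<U>" "(\<Sum>U\<in>\<U>. diameter U powr s) < c"
    by (rule not_content_geE) (rule that)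
  have *: "\<exists>\<eta>>0. \<forall>x\<in>Q - \<Union>\<U>. 2 * \<eta> \<le> \<bar>f x - r\<bar>"
  proof (cases "Q - \<Union>\<U> = {}")
    case True
    then show ?thesis by (intro exI[of _ 1]) auto
  next
    case False
    have "open (\<Union>\<U>)" using \<U>(2) by auto
    then have "compact (Q - \<Union>\<U>)" using assms(1) by (simp add: compact_diff)
    moreover have "continuous_on (Q - \<Union>\<U>) (\<lambda>x. \<bar>f x - r\<bar>)"
      using assms(2) by (intro continuous_intros) (auto intro: continuous_on_subset)
    ultimately obtain z where z: "z \<in> Q - \<Union>\<U>" "\<forall>x\<in>Q - \<Union>\<U>. \<bar>f z - r\<bar> \<le> \<bar>f x - r\<bar>"
      using continuous_attains_inf[of "Q - \<Union>\<U>" "\<lambda>x. \<bar>f x - r\<bar>"] False by auto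
    then have "f z \<noteq> r" using \<U>(4) by blast
    with z show ?thesis by (intro exI[of _ "\<bar>f z - r\<bar> / 2"]) auto
  qed
  then obtain \<eta> where \<eta>: "\<eta> > 0" "\<And>x. x \<in> Q - \<Union>\<U> \<Longrightarrow> 2 * \<eta> \<le> \<bar>f x - r\<bar>" by blast
  show thesis
  proof (rule that[OF \<open>\<eta> > 0\<close>])
    fix g r'
    assume g: "\<And>x. x \<in> Q \<Longrightarrow> \<bar>g x - f x\<bar> < \<eta>" and r': "\<bar>r' - r\<bar> < \<eta>"
    have "x \<in> \<Union>\<U>" if "x \<in> Q" "g x = r'" for x
      using \<eta>(2)[of x] g[of x] r' that by (cases "x \<in> \<Union>\<U>") auto
    then have "{x \<in> Q. g x = r'} \<subseteq> \<Union>\<U>" by auto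
    then show "r' \<notin> large_levels s c g Q"
      unfolding large_levels_def mem_Collect_eq
      using \<U>(1,2,3,5) by (intro not_content_geI)
  qed
qed

lemma compact_large_levels:
  fixes f :: "'a::metric_space \<Rightarrow> real"
  assumes "compact Q" "continuous_on Q f" "c > 0"
  shows "compact (large_levels s c f Q)"
proof -
  have "open (- large_levels s c f Q)"
    unfolding open_dist
  proof
    fix r assume "r \<in> - large_levels s c f Q"
    then obtain \<eta> where "\<eta> > 0" "\<And>r'. \<bar>r' - r\<bar> < \<eta> \<Longrightarrow> r' \<notin> large_levels s c f Q"
      using small_level_stable[OF assms(1,2), of r s c] by (metis ComplD abs_zero diff_self)
    then show "\<exists>e>0. \<forall>y. dist y r < e \<longrightarrow> y \<in> - large_levels s c f Q"
      by (auto simp: dist_real_def)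
  qed
  moreover have "bounded (large_levels s c f Q)"
    using large_levels_subset_image[OF \<open>c > 0\<close>] compact_continuous_image[OF assms(2,1)]
    by (meson bounded_subset compact_imp_bounded)
  ultimately show ?thesis
    by (simp add: compact_eq_bounded_closed closed_def)
qed

text \<open>
  The levels in question lie in a fixed compact interval. What remains of it outside \<open>W\<close> is compact,
  and its points are small levels in the stable sense just established.
\<close>
lemma large_levels_upper_semicontinuous:
  fixes f :: "'a::metric_space \<Rightarrow> real"
  assumes "compact Q" "continuous_on Q f" "c > 0" "open W" "large_levels s c f Q \<subseteq> W"
  obtains \<eta> where "\<eta> > 0"
    "\<And>g. (\<And>x. x \<in> Q \<Longrightarrow> \<bar>g x - f x\<bar> < \<eta>) \<Longrightarrow> large_levels s c g Q \<subseteq> W"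
proof -
  have "bounded (f ` Q)"
    using assms by (simp add: compact_continuous_image compact_imp_bounded)
  then obtain B where B: "\<And>x. x \<in> Q \<Longrightarrow> \<bar>f x\<bar> \<le> B"
    unfolding bounded_iff by auto
  define K where "K = {-(B + 1)..B + 1} - W"
  have "compact K" unfolding K_def using \<open>open W\<close> by (intro compact_diff) auto
  have "\<exists>\<eta>>0. \<forall>g r'. (\<forall>x\<in>Q. \<bar>g x - f x\<bar> < \<eta>) \<longrightarrow> \<bar>r' - r\<bar> < \<eta> \<longrightarrow> r' \<notin> large_levels s c g Q"
    if "r \<in> K" for r
  proof -
    have "r \<notin> large_levels s c f Q" using that assms(5) by (auto simp: K_def)
    from small_level_stable[OF assms(1,2) this] show ?thesis by metis
  qed
  then obtain \<eta> where \<eta>: "\<And>r. r \<in> K \<Longrightarrow> \<eta> r > 0"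
    "\<And>r g r'. r \<in> K \<Longrightarrow> (\<And>x. x \<in> Q \<Longrightarrow> \<bar>g x - f x\<bar> < \<eta> r) \<Longrightarrow> \<bar>r' - r\<bar> < \<eta> r
       \<Longrightarrow> r' \<notin> large_levels s c g Q"
    by metis
  have "K \<subseteq> (\<Union>r\<in>K. ball r (\<eta> r))" using \<eta>(1) by auto
  then obtain I where I: "I \<subseteq> K" "finite I" "K \<subseteq> (\<Union>r\<in>I. ball r (\<eta> r))"
    using compactE_image[OF \<open>compact K\<close>, of K "\<lambda>r. ball r (\<eta> r)"] by auto
  define e where "e = Min (insert 1 (\<eta> ` I))"
  have e: "e > 0" "e \<le> 1" "\<And>r. r \<in> I \<Longrightarrow> e \<le> \<eta> r"
    using I \<eta>(1) by (auto simp: e_def)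
  show thesis
  proof (rule that[OF e(1)])
    fix g assume g: "\<And>x. x \<in> Q \<Longrightarrow> \<bar>g x - f x\<bar> < e"
    show "large_levels s c g Q \<subseteq> W"
    proof
      fix r assume r: "r \<in> large_levels s c g Q"
      then obtain x where x: "x \<in> Q" "g x = r"
        using large_levels_subset_image[OF \<open>c > 0\<close>, of s g Q] by auto
      show "r \<in> W"
      proof (rule ccontr)
        assume "r \<notin> W"
        moreover have "\<bar>r\<bar> \<le> B + 1" using B[OF x(1)] g[OF x(1)] e(2) x(2) by linarith
        ultimately have "r \<in> K" by (auto simp: K_def)
        then obtain r0 where r0: "r0 \<in> I" "\<bar>r - r0\<bar> < \<eta> r0"
          using I(3) by (auto simp: dist_real_def abs_minus_commute)
        have "r \<notin> large_levels s c g Q"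
        proof (rule \<eta>(2)[of r0])
          show "\<bar>g x - f x\<bar> < \<eta> r0" if "x \<in> Q" for x
            using g[OF that] e(3)[OF r0(1)] by linarith
        qed (use r0 I in auto)
        with r show False by simp
      qed
    qed
  qed
qed

lemma emeasure_large_levels_upper_semicontinuous:
  fixes f :: "'a::metric_space \<Rightarrow> real"
  assumes "compact Q" "continuous_on Q f" "c > 0" "emeasure lebesgue (large_levels s c f Q) < ennreal m"
  obtains \<eta> where "\<eta> > 0"
    "\<And>g. (\<forall>x\<in>Q. \<bar>g x - f x\<bar> < \<eta>) \<Longrightarrow> emeasure lebesgue (large_levels s c g Q) < ennreal m"
proof -
  define S where "S = large_levels s c f Q"
  have "compact S" unfolding S_def using assms(1-3) by (rule compact_large_levels)
  then have S: "S \<in> sets lebesgue" by (rule compact_in_sets_lebesgue)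
  have fin: "emeasure lebesgue S = ennreal (measure lebesgue S)"
    using assms(4) unfolding S_def by (intro emeasure_eq_ennreal_measure) auto
  then have m: "measure lebesgue S < m"
    using assms(4) by (simp add: S_def ennreal_less_iff)
  obtain W where W: "open W" "S \<subseteq> W" "W - S \<in> lmeasurable"
      "emeasure lebesgue (W - S) < ennreal (m - measure lebesgue S)"
    using sets_lebesgue_outer_open[OF S, of "m - measure lebesgue S"] m by auto
  have "emeasure lebesgue W = emeasure lebesgue S + emeasure lebesgue (W - S)"
    using W S by (subst plus_emeasure) (auto simp: Un_absorb1 fmeasurableD)
  also have "\<dots> < ennreal (measure lebesgue S) + ennreal (m - measure lebesgue S)"
    unfolding fin using W(4) by (simp add: ennreal_add_left_cancel_less)
  also have "\<dots> = ennreal m"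
    using m by (subst ennreal_plus[symmetric]) auto
  finally have W_less: "emeasure lebesgue W < ennreal m" .
  obtain \<eta> where \<eta>: "\<eta> > 0" "\<And>g. (\<And>x. x \<in> Q \<Longrightarrow> \<bar>g x - f x\<bar> < \<eta>) \<Longrightarrow> large_levels s c g Q \<subseteq> W"
    using large_levels_upper_semicontinuous[OF assms(1-3) W(1) W(2)[unfolded S_def]] by metis
  show thesis
  proof (rule that[OF \<eta>(1)])
    fix g assume "\<forall>x\<in>Q. \<bar>g x - f x\<bar> < \<eta>"
    then have "large_levels s c g Q \<subseteq> W" using \<eta>(2) by blast
    then have "emeasure lebesgue (large_levels s c g Q) \<le> emeasure lebesgue W"
      using W(1) by (intro emeasure_mono) auto
    with W_less show "emeasure lebesgue (large_levels s c g Q) < ennreal m" by simp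
  qed
qed

text \<open>
  Measurability matters here beyond bookkeeping: \<^const>\<open>emeasure\<close> is 0 on non-measurable sets, so it
  has to be known before a lower bound for \<^const>\<open>D_star_fun\<close> can be drawn from a subset.
\<close>
lemma sets_level_dim_ge:
  fixes f :: "'a::metric_space \<Rightarrow> real"
  assumes "compact F" "continuous_on F f"
  shows "{r. ennreal s \<le> level_dim f r F} \<in> sets lebesgue"
proof -
  have "ennreal s \<le> level_dim f r F \<longleftrightarrow>
      (\<forall>t\<in>\<rat> \<inter> {0<..<s}. \<exists>n. r \<in> large_levels t (1 / Suc n) f F)" for r
    unfolding level_dim_def large_levels_def mem_Collect_eq
    by (rule hausdorff_dim_ge_iff_content[OF compact_level_set[OF assms]])
  then have "{r. ennreal s \<le> level_dim f r F} =
      (\<Inter>t\<in>\<rat> \<inter> {0<..<s}. \<Union>n. large_levels t (1 / Suc n) f F)"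
    by auto
  also have "\<dots> \<in> sets lebesgue"
  proof (rule sets.countable_INT'')
    fix t
    have "large_levels t (1 / Suc n) f F \<in> sets lebesgue" for n
      using compact_large_levels[OF assms, of "1 / Suc n" t] by (intro compact_in_sets_lebesgue) simp
    then show "(\<Union>n. large_levels t (1 / Suc n) f F) \<in> sets lebesgue"
      by (intro sets.countable_UN) auto
  next
    show "countable (\<rat> \<inter> {0<..<s})"
      using countable_rat by (rule countable_subset[rotated]) auto
  qed simp
  finally show ?thesis .
qed

lemma D_star_fun_ge:
  fixes f :: "'a::metric_space \<Rightarrow> real"
  assumes "compact F" "continuous_on F f" "Q \<subseteq> F" "c > 0"
    and pos: "emeasure lebesgue (large_levels s c f Q) > 0"
  shows "ennreal s \<le> D_star_fun f F"
proof -
  have "large_levels s c f Q \<subseteq> {r. ennreal s \<le> level_dim f r F}"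
  proof
    fix r assume "r \<in> large_levels s c f Q"
    then have "content_ge s c {x \<in> F. f x = r}"
      using large_levels_mono[OF \<open>Q \<subseteq> F\<close> order_refl] by (auto simp: large_levels_def)
    then have "ennreal s \<le> level_dim f r F"
      unfolding level_dim_def
      using compact_level_set[OF assms(1,2)] \<open>c > 0\<close> by (intro content_ge_imp_hausdorff_dim_ge)
    then show "r \<in> {r. ennreal s \<le> level_dim f r F}" by simp
  qed
  then have "emeasure lebesgue (large_levels s c f Q) \<le> emeasure lebesgue {r. ennreal s \<le> level_dim f r F}"
    using sets_level_dim_ge[OF assms(1,2)] by (rule emeasure_mono)
  with pos show ?thesis
    unfolding D_star_fun_def by (intro Sup_upper) auto
qed

text \<open>
  A set of positive measure is not a countable union of null sets. This singles out one piece \<open>Q j\<close> and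
  one content bound; enlarging \<open>n\<close> weakens the content bound, so a single \<open>n\<close> can control both the
  content and the measure.
\<close>
lemma D_star_fun_gt_imp_large_levels:
  fixes f :: "'a::metric_space \<Rightarrow> real"
  assumes "s > 0" "ennreal s < D_star_fun f F"
    and J: "finite J" "F = (\<Union>j\<in>J. Q j)" "\<And>j. j \<in> J \<Longrightarrow> compact (Q j)" and "continuous_on F f"
  obtains j n where "j \<in> J"
    "ennreal (1 / Suc n) \<le> emeasure lebesgue (large_levels s (1 / Suc n) f (Q j))"
proof -
  obtain d where d: "ennreal s < d" "emeasure lebesgue {r. d \<le> level_dim f r F} > 0"
    using assms(2) unfolding D_star_fun_def less_Sup_iff by auto
  define L where "L p = large_levels s (1 / Suc (snd p)) f (Q (fst p))" for p
  have L_sets: "L p \<in> sets lebesgue" if "p \<in> J \<times> UNIV" for p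
  proof -
    have "continuous_on (Q (fst p)) f"
      using that unfolding J(2) by (intro continuous_on_subset[OF \<open>continuous_on F f\<close>[unfolded J(2)]]) auto
    then have "compact (L p)"
      unfolding L_def using J(3) that by (intro compact_large_levels) auto
    then show ?thesis by (rule compact_in_sets_lebesgue)
  qed
  have cover: "{r. d \<le> level_dim f r F} \<subseteq> (\<Union>p\<in>J \<times> UNIV. L p)"
  proof clarify
    fix r assume "d \<le> level_dim f r F"
    then have "ennreal s < hausdorff_dim {x \<in> F. f x = r}"
      using d(1) by (simp add: level_dim_def)
    then obtain c where "c > 0" "content_ge s c {x \<in> F. f x = r}"
      using hausdorff_dim_gt_imp_content_ge \<open>s > 0\<close> by blast
    moreover have "{x \<in> F. f x = r} = (\<Union>j\<in>J. {x \<in> Q j. f x = r})"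
      using J(2) by auto
    ultimately obtain j e where j: "j \<in> J" "e > 0" "content_ge s e {x \<in> Q j. f x = r}"
      using content_ge_finite_UN[OF J(1), of s c "\<lambda>j. {x \<in> Q j. f x = r}"] by auto
    obtain n where "1 / Suc n < e"
      using \<open>e > 0\<close> by (rule nat_approx_posE)
    then have "content_ge s (1 / Suc n) {x \<in> Q j. f x = r}"
      using content_ge_mono[OF j(3) order_refl] by simp
    then have "r \<in> L (j, n)" by (simp add: L_def large_levels_def)
    with j show "r \<in> (\<Union>p\<in>J \<times> UNIV. L p)" by blast
  qed
  have "\<exists>p\<in>J \<times> UNIV. emeasure lebesgue (L p) \<noteq> 0"
  proof (rule ccontr)
    assume "\<not> ?thesis"
    then have "(\<Union>p\<in>J \<times> UNIV. L p) \<in> null_sets lebesgue"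
      using L_sets J(1) by (intro null_sets_UN') (auto simp: countable_finite null_sets_def)
    then have "emeasure lebesgue {r. d \<le> level_dim f r F} = 0"
      using cover emeasure_mono[OF cover, of lebesgue] by (auto simp: null_sets_def)
    with d(2) show False by simp
  qed
  then obtain j n where j: "j \<in> J" "emeasure lebesgue (L (j, n)) > 0"
    by (auto simp: zero_less_iff_neq_zero)
  obtain e where e: "e > 0" "ennreal e < emeasure lebesgue (L (j, n))"
  proof -
    obtain y where y: "0 < y" "y < emeasure lebesgue (L (j, n))"
      using dense[OF j(2)] by blast
    then obtain e where "e \<ge> 0" "y = ennreal e"
      by (metis ennreal_cases less_top_ennreal not_less_iff_gr_or_eq top_greatest not_le)
    with y that show thesis by (auto simp: less_le)
  qed
  obtain k where k: "1 / Suc k < e" using \<open>e > 0\<close> by (rule nat_approx_posE)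
  define N where "N = max n k"
  have "1 / Suc N \<le> 1 / Suc k" "1 / Suc N \<le> 1 / Suc n"
    by (auto simp: N_def divide_simps)
  have "ennreal (1 / Suc N) \<le> ennreal e"
    using k \<open>1 / Suc N \<le> 1 / Suc k\<close> by (intro ennreal_leI) linarith
  also have "\<dots> \<le> emeasure lebesgue (L (j, n))" using e by simp
  also have "\<dots> \<le> emeasure lebesgue (L (j, N))"
  proof (rule emeasure_mono)
    show "L (j, n) \<subseteq> L (j, N)"
      unfolding L_def using \<open>1 / Suc N \<le> 1 / Suc n\<close> by (intro large_levels_mono) auto
    show "L (j, N) \<in> sets lebesgue" using j by (intro L_sets) auto
  qed
  finally show thesis using that j by (simp add: L_def)
qed

section \<open>The Baire property of spaces of Hoelder functions\<close>

text \<open>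
  If all the \<open>K i\<close> had empty interior, their complements and the open sets that define \<open>G\<close> would be
  countably many dense open sets with empty intersection.
\<close>
lemma dense_gdelta_countable_closed_cover:
  assumes X: "completely_metrizable_space X" "topspace X \<noteq> {}"
    and G: "gdelta_in X G" "X closure_of G = topspace X"
    and K: "countable I" "\<And>i. i \<in> I \<Longrightarrow> closedin X (K i)" "G \<subseteq> (\<Union>i\<in>I. K i)"
  shows "\<exists>i\<in>I. X interior_of (K i) \<noteq> {}"
proof (rule ccontr)
  assume no: "\<not> ?thesis"
  obtain C :: "nat \<Rightarrow> 'a set" where C: "\<And>n. openin X (C n)" "\<Inter>(range C) = G"
    using G(1) unfolding gdelta_in_descending by auto
  define \<G> where "\<G> = range C \<union> (\<lambda>i. topspace X - K i) ` I"
  have "X closure_of \<Inter>\<G> = topspace X"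
  proof (rule Baire_category)
    show "countable \<G>" using K(1) by (simp add: \<G>_def)
    show "openin X T \<and> X closure_of T = topspace X" if "T \<in> \<G>" for T
      using that unfolding \<G>_def
    proof
      assume "T \<in> range C"
      then obtain n where n: "T = C n" by auto
      have "G \<subseteq> C n" using C(2) by auto
      then have "topspace X \<subseteq> X closure_of (C n)"
        using closure_of_mono[of G "C n" X] G(2) by simp
      with C(1) n show ?thesis
        using closure_of_subset_topspace[of X "C n"] by auto
    next
      assume "T \<in> (\<lambda>i. topspace X - K i) ` I"
      with no K(2) show ?thesis
        by (auto simp: closure_of_complement)
    qed
  qed (use X in simp)
  moreover have "\<Inter>\<G> = {}"
  proof -
    have "\<Inter>\<G> = G \<inter> (\<Inter>i\<in>I. topspace X - K i)"
      using C(2) by (auto simp: \<G>_def)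
    also have "\<dots> = {}" using K(3) by auto
    finally show ?thesis .
  qed
  ultimately show False using X(2) by simp
qed

lemma holder_space_mdist_le:
  assumes "f \<in> mspace (holder_space \<alpha> F)" "g \<in> mspace (holder_space \<alpha> F)"
    and "\<And>x. x \<in> F \<Longrightarrow> \<bar>f x - g x\<bar> \<le> e" "0 \<le> e"
  shows "mdist (holder_space \<alpha> F) f g \<le> e"
proof (cases "F = {}")
  case False
  have "mdist (funspace F euclidean_metric) f g \<le> e"
    using assms False by (subst funspace_mdist_le) (auto simp: holder_space_def dist_real_def)
  then show ?thesis by (simp add: holder_space_def)
qed (use assms in \<open>simp add: holder_space_def Met_TC.fdist_def\<close>)

lemma abs_diff_le_holder_space_mdist:
  assumes "f \<in> mspace (holder_space \<alpha> F)" "g \<in> mspace (holder_space \<alpha> F)" "x \<in> F"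
  shows "\<bar>f x - g x\<bar> \<le> mdist (holder_space \<alpha> F) f g"
proof -
  have fg: "f \<in> mspace (funspace F euclidean_metric)" "g \<in> mspace (funspace F euclidean_metric)"
    using assms by (auto simp: holder_space_def)
  have "F \<noteq> {}" using assms by auto
  then show ?thesis
    using funspace_mdist_le[OF fg, of "mdist (funspace F euclidean_metric) f g"] assms(3)
    by (auto simp: holder_space_def dist_real_def)
qed

text \<open>
  Expressing openness by pointwise bounds on \<open>F\<close> also covers the empty set \<open>F\<close>, for which the
  supremum of the pointwise distances has no meaning.
\<close>
lemma openin_holder_space:
  "openin (mtopology_of (holder_space \<alpha> F)) U \<longleftrightarrow>
     U \<subseteq> mspace (holder_space \<alpha> F) \<and>
     (\<forall>f\<in>U. \<exists>e>0. \<forall>g\<in>mspace (holder_space \<alpha> F). (\<forall>x\<in>F. \<bar>g x - f x\<bar> < e) \<longrightarrow> g \<in> U)"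
    (is "?L \<longleftrightarrow> ?R")
proof -
  let ?M = "mspace (holder_space \<alpha> F)" and ?d = "mdist (holder_space \<alpha> F)"
  interpret Metric_space ?M ?d by (rule Metric_space_mspace_mdist)
  have L: "?L \<longleftrightarrow> U \<subseteq> ?M \<and> (\<forall>f. f \<in> U \<longrightarrow> (\<exists>r>0. mball f r \<subseteq> U))"
    unfolding mtopology_of_def by (rule openin_mtopology)
  show ?thesis
  proof
    assume ?L
    with L have U: "U \<subseteq> ?M" "\<And>f. f \<in> U \<Longrightarrow> \<exists>r>0. mball f r \<subseteq> U" by auto
    show ?R
    proof (intro conjI ballI U(1))
      fix f assume f: "f \<in> U"
      then obtain r where r: "r > 0" "mball f r \<subseteq> U" using U(2) by blast
      have "g \<in> U" if g: "g \<in> ?M" "\<forall>x\<in>F. \<bar>g x - f x\<bar> < r / 2" for g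
      proof -
        have "?d f g \<le> r / 2"
          using f g U(1) r(1) by (intro holder_space_mdist_le) (auto simp: abs_minus_commute less_imp_le)
        then have "g \<in> mball f r" using f g U(1) r(1) by auto
        with r show ?thesis by blast
      qed
      then show "\<exists>e>0. \<forall>g\<in>?M. (\<forall>x\<in>F. \<bar>g x - f x\<bar> < e) \<longrightarrow> g \<in> U"
        using r(1) by (intro exI[of _ "r / 2"]) auto
    qed
  next
    assume R: ?R
    show ?L
      unfolding L
    proof (intro conjI allI impI)
      show "U \<subseteq> ?M" using R by blast
      fix f assume f: "f \<in> U"
      then obtain e where e: "e > 0" "\<And>g. g \<in> ?M \<Longrightarrow> (\<forall>x\<in>F. \<bar>g x - f x\<bar> < e) \<Longrightarrow> g \<in> U"
        using R by blast
      have "g \<in> U" if g: "g \<in> mball f e" for g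
      proof (rule e(2))
        show "\<forall>x\<in>F. \<bar>g x - f x\<bar> < e"
          using g abs_diff_le_holder_space_mdist[of f \<alpha> F g] by (auto simp: abs_minus_commute intro: le_less_trans)
      qed (use g in auto)
      with e(1) show "\<exists>r>0. mball f r \<subseteq> U" by blast
    qed
  qed
qed

text \<open>
  The Hoelder condition is preserved under pointwise limits, so the space is closed in the complete
  space of bounded functions.
\<close>
lemma completely_metrizable_holder_space:
  "completely_metrizable_space (mtopology_of (holder_space \<alpha> F))"
proof -
  let ?N = "mspace (funspace F euclidean_metric) :: ('a \<Rightarrow> real) set"
  let ?d = "mdist (funspace F euclidean_metric) :: ('a \<Rightarrow> real) \<Rightarrow> _"
  let ?M = "mspace (holder_space \<alpha> F)"
  have M: "?M = {f. holder1_on \<alpha> F f} \<inter> ?N"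
    by (simp add: holder_space_def)
  have "Metric_space ?N ?d" by (rule Metric_space_mspace_mdist)
  then interpret S: Submetric ?N ?d ?M
    using M by (auto simp: Submetric_def Submetric_axioms_def)
  have "closedin S.mtopology ?M"
    unfolding S.closedin_metric
  proof (intro conjI allI impI)
    show "?M \<subseteq> ?N" using M by auto
    fix f assume f: "f \<in> ?N - ?M"
    then obtain x y where xy: "x \<in> F" "y \<in> F" "dist x y powr \<alpha> < \<bar>f x - f y\<bar>"
      using M by (auto simp: holder1_on_def not_le)
    define r where "r = (\<bar>f x - f y\<bar> - dist x y powr \<alpha>) / 2"
    have "g \<notin> S.mball f r" if g: "g \<in> ?M" for g
    proof
      assume "g \<in> S.mball f r"
      then have fg: "f \<in> ?N" "g \<in> ?N" "?d f g < r"
        unfolding S.in_mball by blast+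
      have "F \<noteq> {}" using xy by auto
      then have "\<forall>z\<in>F. \<bar>f z - g z\<bar> \<le> ?d f g"
        using funspace_mdist_le[OF fg(1,2), of "?d f g"] by (simp add: dist_real_def)
      then have "\<bar>f x - g x\<bar> < r" "\<bar>f y - g y\<bar> < r"
        using xy fg(3) by (meson le_less_trans)+
      moreover have "\<bar>g x - g y\<bar> \<le> dist x y powr \<alpha>"
        using g xy M by (auto simp: holder1_on_def)
      moreover have "\<bar>f x - f y\<bar> \<le> \<bar>f x - g x\<bar> + \<bar>g x - g y\<bar> + \<bar>f y - g y\<bar>"
        by linarith
      ultimately show False unfolding r_def by argo
    qed
    then show "\<exists>r>0. disjnt ?M (S.mball f r)"
      using xy(3) by (intro exI[of _ r]) (auto simp: r_def disjnt_def)
  qed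
  moreover have "S.mcomplete"
  proof -
    have "mcomplete_of (funspace F (euclidean_metric :: real metric))"
      using Met_TC.mcomplete_funspace[where 'a = real, of F] complete_UNIV
      by (simp add: Met_TC.Self_def euclidean_metric_def)
    then show ?thesis by (simp add: mcomplete_of_def)
  qed
  ultimately have "S.sub.mcomplete"
    using S.closedin_eq_mcomplete by blast
  then have "completely_metrizable_space S.sub.mtopology"
    by (rule S.sub.completely_metrizable_space_mtopology)
  moreover have "mtopology_of (holder_space \<alpha> F) = S.sub.mtopology"
    by (simp add: mtopology_of_def holder_space_def)
  ultimately show ?thesis by (simp only:)
qed

lemma open_dense_in_dense_gdeltas:
  assumes "openin (mtopology_of (holder_space \<alpha> F)) U"
    and dense: "\<And>f e. f \<in> mspace (holder_space \<alpha> F) \<Longrightarrow> e > 0 \<Longrightarrow> \<exists>g\<in>U. \<forall>x\<in>F. \<bar>g x - f x\<bar> < e"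
  shows "U \<in> dense_gdeltas \<alpha> F"
proof -
  let ?M = "mspace (holder_space \<alpha> F)" and ?d = "mdist (holder_space \<alpha> F)"
  interpret Metric_space ?M ?d by (rule Metric_space_mspace_mdist)
  have U: "U \<subseteq> ?M" using assms(1) openin_subset by fastforce
  have "\<exists>g\<in>U. g \<in> mball f r" if f: "f \<in> ?M" "r > 0" for f r
  proof -
    obtain g where g: "g \<in> U" "\<forall>x\<in>F. \<bar>g x - f x\<bar> < r / 2"
      using dense[of f "r / 2"] f by auto
    have "?d f g \<le> r / 2"
      using f g U by (intro holder_space_mdist_le) (auto simp: abs_minus_commute less_imp_le)
    with f g U have "g \<in> mball f r" by auto
    with g show ?thesis by blast
  qed
  then have "mtopology closure_of U = ?M"
    unfolding metric_closure_of by blast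
  with assms(1) show ?thesis
    by (simp add: dense_gdeltas_def open_imp_gdelta_in mtopology_of_def)
qed

lemma dense_gdelta_holder_space_cover:
  assumes G: "G \<in> dense_gdeltas \<alpha> F" and "countable I" "G \<subseteq> (\<Union>i\<in>I. K i)"
    and ne: "mspace (holder_space \<alpha> F) \<noteq> {}"
    and stable: "\<And>i f. i \<in> I \<Longrightarrow> f \<in> mspace (holder_space \<alpha> F) \<Longrightarrow> f \<notin> K i \<Longrightarrow>
      \<exists>e>0. \<forall>g\<in>mspace (holder_space \<alpha> F). (\<forall>x\<in>F. \<bar>g x - f x\<bar> < e) \<longrightarrow> g \<notin> K i"
  obtains i f e where "i \<in> I" "f \<in> mspace (holder_space \<alpha> F)" "e > 0"
    "\<And>g. g \<in> mspace (holder_space \<alpha> F) \<Longrightarrow> (\<forall>x\<in>F. \<bar>g x - f x\<bar> < e) \<Longrightarrow> g \<in> K i"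
proof -
  let ?X = "mtopology_of (holder_space \<alpha> F)" and ?M = "mspace (holder_space \<alpha> F)"
  have "\<exists>i\<in>I. ?X interior_of (?M \<inter> K i) \<noteq> {}"
  proof (rule dense_gdelta_countable_closed_cover)
    show "completely_metrizable_space ?X" by (rule completely_metrizable_holder_space)
    show "topspace ?X \<noteq> {}" using ne by simp
    show gd: "gdelta_in ?X G" and "?X closure_of G = topspace ?X"
      using G by (auto simp: dense_gdeltas_def)
    show "G \<subseteq> (\<Union>i\<in>I. ?M \<inter> K i)"
      using assms(3) gdelta_in_subset[OF gd] by auto
    show "countable I" by fact
    show "closedin ?X (?M \<inter> K i)" if "i \<in> I" for i
      unfolding closedin_def
    proof
      have "topspace ?X - ?M \<inter> K i = ?M - K i" by auto
      moreover have "openin ?X (?M - K i)"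
        unfolding openin_holder_space using stable[OF that] by auto
      ultimately show "openin ?X (topspace ?X - ?M \<inter> K i)" by simp
    qed simp
  qed
  then obtain i f where i: "i \<in> I" "f \<in> ?X interior_of (?M \<inter> K i)" by auto
  have "openin ?X (?X interior_of (?M \<inter> K i))" by (rule openin_interior_of)
  then obtain e where e: "e > 0"
      "\<forall>g\<in>?M. (\<forall>x\<in>F. \<bar>g x - f x\<bar> < e) \<longrightarrow> g \<in> ?X interior_of (?M \<inter> K i)"
    unfolding openin_holder_space using i(2) by auto
  have "?X interior_of (?M \<inter> K i) \<subseteq> ?M \<inter> K i" by (rule interior_of_subset)
  with i e that[of i f e] show thesis by auto
qed

section \<open>Approximation and truncation of Hoelder functions\<close>

lemma powr_add_le:
  fixes a b \<alpha> :: real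
  assumes "0 \<le> a" "0 \<le> b" "0 < \<alpha>" "\<alpha> \<le> 1"
  shows "(a + b) powr \<alpha> \<le> a powr \<alpha> + b powr \<alpha>"
proof (cases "a + b = 0")
  case True
  with assms show ?thesis by (simp add: add_nonneg_eq_0_iff)
next
  case False
  then have pos: "a + b > 0" using assms by simp
  have part: "t / (a + b) * (a + b) powr \<alpha> \<le> t powr \<alpha>" if "0 \<le> t" "t \<le> a + b" for t
  proof -
    have "t / (a + b) \<le> (t / (a + b)) powr \<alpha>"
      using powr_mono'[of \<alpha> 1 "t / (a + b)"] assms pos that by simp
    also have "\<dots> = t powr \<alpha> / (a + b) powr \<alpha>"
      using that pos by (simp add: powr_divide)
    finally show ?thesis using pos by (simp add: field_simps)
  qed
  have "(a + b) powr \<alpha> = a / (a + b) * (a + b) powr \<alpha> + b / (a + b) * (a + b) powr \<alpha>"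
    using pos by (simp add: add_divide_distrib[symmetric] distrib_right[symmetric])
  with part[of a] part[of b] assms show ?thesis by linarith
qed

text \<open>
  Shifting the argument of \<open>t powr \<alpha>\<close> away from the singularity at 0 makes it Lipschitz on the
  nonnegative reals and preserves its Hoelder constant. The Lipschitz bound comes from Bernoulli's
  inequality \<open>(1 + x) powr \<alpha> \<le> 1 + x\<close>.
\<close>
lemma shifted_powr_diff_le:
  fixes a b \<alpha> \<delta> :: real
  assumes "0 \<le> a" "0 \<le> b" "0 < \<alpha>" "\<alpha> \<le> 1" "\<delta> > 0"
  shows "\<bar>(a + \<delta>) powr \<alpha> - (b + \<delta>) powr \<alpha>\<bar> \<le> \<bar>a - b\<bar> powr \<alpha>"
    and "\<bar>(a + \<delta>) powr \<alpha> - (b + \<delta>) powr \<alpha>\<bar> \<le> \<delta> powr (\<alpha> - 1) * \<bar>a - b\<bar>"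
proof -
  have main: "0 \<le> (b + \<delta> + t) powr \<alpha> - (b + \<delta>) powr \<alpha> \<and>
      (b + \<delta> + t) powr \<alpha> - (b + \<delta>) powr \<alpha> \<le> t powr \<alpha> \<and>
      (b + \<delta> + t) powr \<alpha> - (b + \<delta>) powr \<alpha> \<le> \<delta> powr (\<alpha> - 1) * t"
    if "0 \<le> b" "0 \<le> t" for b t
  proof (intro conjI)
    define p where "p = b + \<delta>"
    have p: "p > 0" "\<delta> \<le> p" using assms that by (auto simp: p_def)
    have "p powr \<alpha> \<le> (p + t) powr \<alpha>"
      using p that assms by (intro powr_mono2) auto
    then show "0 \<le> (b + \<delta> + t) powr \<alpha> - (b + \<delta>) powr \<alpha>" by (simp add: p_def)
    show "(b + \<delta> + t) powr \<alpha> - (b + \<delta>) powr \<alpha> \<le> t powr \<alpha>"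
      using powr_add_le[of p t \<alpha>] p that assms by (simp add: p_def)
    have "(p + t) powr \<alpha> = p powr \<alpha> * (1 + t / p) powr \<alpha>"
      using p that by (simp add: powr_mult[symmetric] distrib_left)
    also have "\<dots> \<le> p powr \<alpha> * (1 + t / p)"
      using powr_mono[of \<alpha> 1 "1 + t / p"] p that assms by (intro mult_left_mono) auto
    also have "\<dots> = p powr \<alpha> + p powr (\<alpha> - 1) * t"
      using p by (simp add: powr_diff field_simps)
    also have "\<dots> \<le> p powr \<alpha> + \<delta> powr (\<alpha> - 1) * t"
      using p that assms by (intro add_left_mono mult_right_mono powr_mono2') auto
    finally show "(b + \<delta> + t) powr \<alpha> - (b + \<delta>) powr \<alpha> \<le> \<delta> powr (\<alpha> - 1) * t"
      by (simp add: p_def)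
  qed
  have "\<bar>(a + \<delta>) powr \<alpha> - (b + \<delta>) powr \<alpha>\<bar> \<le> \<bar>a - b\<bar> powr \<alpha> \<and>
      \<bar>(a + \<delta>) powr \<alpha> - (b + \<delta>) powr \<alpha>\<bar> \<le> \<delta> powr (\<alpha> - 1) * \<bar>a - b\<bar>"
  proof (cases "a \<le> b")
    case True
    with main[of a "b - a"] assms show ?thesis by (simp add: abs_if add.commute)
  next
    case False
    with main[of b "a - b"] assms show ?thesis by (simp add: abs_if add.commute)
  qed
  then show "\<bar>(a + \<delta>) powr \<alpha> - (b + \<delta>) powr \<alpha>\<bar> \<le> \<bar>a - b\<bar> powr \<alpha>"
    and "\<bar>(a + \<delta>) powr \<alpha> - (b + \<delta>) powr \<alpha>\<bar> \<le> \<delta> powr (\<alpha> - 1) * \<bar>a - b\<bar>"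
    by auto
qed

lemma abs_INF_diff_le:
  fixes u v :: "'b \<Rightarrow> real"
  assumes "A \<noteq> {}" "bdd_below (u ` A)" "bdd_below (v ` A)" "\<And>y. y \<in> A \<Longrightarrow> \<bar>u y - v y\<bar> \<le> \<rho>"
  shows "\<bar>(INF y\<in>A. u y) - (INF y\<in>A. v y)\<bar> \<le> \<rho>"
proof -
  have "(INF y\<in>A. u y) \<le> (INF y\<in>A. v y) + \<rho>" if "bdd_below (u ` A)" "\<And>y. y \<in> A \<Longrightarrow> \<bar>u y - v y\<bar> \<le> \<rho>"
    for u v :: "'b \<Rightarrow> real"
  proof -
    have "(INF y\<in>A. u y) - \<rho> \<le> (INF y\<in>A. v y)"
    proof (rule cINF_greatest[OF \<open>A \<noteq> {}\<close>])
      fix y assume "y \<in> A"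
      then have "(INF y\<in>A. u y) \<le> u y" using that(1) by (intro cINF_lower)
      then show "(INF y\<in>A. u y) - \<rho> \<le> v y" using that(2)[OF \<open>y \<in> A\<close>] by linarith
    qed
    then show ?thesis by linarith
  qed
  from this[of u v] this[of v u] assms show ?thesis
    by (auto simp: abs_le_iff abs_minus_commute algebra_simps)
qed

lemma holder_imp_continuous_on:
  fixes f :: "'a::metric_space \<Rightarrow> real"
  assumes "\<And>x y. x \<in> F \<Longrightarrow> y \<in> F \<Longrightarrow> \<bar>f x - f y\<bar> \<le> M * dist x y powr \<alpha>" "\<alpha> > 0"
  shows "continuous_on F f"
  unfolding continuous_on_def
proof
  fix x assume x: "x \<in> F"
  have "((\<lambda>y. M * dist y x powr \<alpha>) \<longlongrightarrow> M * dist x x powr \<alpha>) (at x within F)"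
    using \<open>\<alpha> > 0\<close> by (intro tendsto_intros) auto
  then have "((\<lambda>y. M * dist y x powr \<alpha>) \<longlongrightarrow> 0) (at x within F)" by simp
  then have "((\<lambda>y. f y - f x) \<longlongrightarrow> 0) (at x within F)"
    by (rule Lim_null_comparison[rotated])
      (use assms(1) x in \<open>auto simp: eventually_at_filter intro!: always_eventually\<close>)
  then show "(f \<longlongrightarrow> f x) (at x within F)" by (simp add: LIM_zero_iff)
qed

text \<open>
  The McShane formula \<open>INF y. f y + (dist x y) powr \<alpha>\<close> reproduces \<open>f\<close>. With the kernel
  \<open>(dist x y + \<delta>) powr \<alpha>\<close> instead, each of the functions in the infimum is Lipschitz with a common
  constant as well as 1-Hoelder-\<open>\<alpha>\<close>, and the infimum exceeds \<open>f\<close> by at most \<open>\<delta> powr \<alpha>\<close>. Being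
  intrinsic to \<open>F\<close>, this works in every metric space. Shrinking by \<open>1 - \<eta>\<close> then brings the Hoelder
  constant below 1.
\<close>
lemma holder_function_approximation:
  fixes f :: "'a::metric_space \<Rightarrow> real"
  assumes "compact F" "0 < \<alpha>" "\<alpha> \<le> 1" "0 < \<beta>" "\<beta> \<le> 1" "holder1_on \<alpha> F f" "e > 0"
  obtains h \<theta> M where "0 \<le> \<theta>" "\<theta> < 1" "M > 0" "\<And>x. x \<in> F \<Longrightarrow> \<bar>h x - f x\<bar> < e"
    "\<And>x y. x \<in> F \<Longrightarrow> y \<in> F \<Longrightarrow> \<bar>h x - h y\<bar> \<le> \<theta> * dist x y powr \<alpha>"
    "\<And>x y. x \<in> F \<Longrightarrow> y \<in> F \<Longrightarrow> \<bar>h x - h y\<bar> \<le> M * dist x y powr \<beta>"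
proof (cases "F = {}")
  case True
  then show thesis by (intro that[of 0 1 f]) auto
next
  case False
  have f: "\<bar>f x - f y\<bar> \<le> dist x y powr \<alpha>" if "x \<in> F" "y \<in> F" for x y
    using assms(6) that by (auto simp: holder1_on_def)
  have "continuous_on F f"
    using f \<open>0 < \<alpha>\<close> by (intro holder_imp_continuous_on[of F f 1 \<alpha>]) auto
  then have "bounded (f ` F)"
    using \<open>compact F\<close> by (simp add: compact_continuous_image compact_imp_bounded)
  then obtain B where B: "B > 0" "\<And>x. x \<in> F \<Longrightarrow> \<bar>f x\<bar> \<le> B"
    unfolding bounded_pos by auto
  define \<delta> where "\<delta> = (e / 4) powr (1 / \<alpha>)"
  have \<delta>: "\<delta> > 0" "\<delta> powr \<alpha> = e / 4" using assms by (auto simp: \<delta>_def powr_powr)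
  define \<eta> where "\<eta> = min 1 (e / (4 * B))"
  have "\<eta> * B \<le> e / (4 * B) * B" using B(1) by (intro mult_right_mono) (auto simp: \<eta>_def)
  then have \<eta>: "0 < \<eta>" "\<eta> \<le> 1" "\<eta> * B \<le> e / 4"
    using B(1) \<open>e > 0\<close> by (auto simp: \<eta>_def)
  define u where "u x y = f y + (dist x y + \<delta>) powr \<alpha>" for x y
  define k where "k x = (INF y\<in>F. u x y)" for x
  have bdd: "bdd_below (u x ` F)" for x
  proof (rule bdd_belowI2)
    fix y assume "y \<in> F"
    with B(2)[of y] have "-B \<le> f y" by auto
    also have "\<dots> \<le> u x y" by (simp add: u_def)
    finally show "-B \<le> u x y" .
  qed
  have k_le: "\<bar>k x - k x'\<bar> \<le> \<rho>"
    if "\<And>y. \<bar>(dist x y + \<delta>) powr \<alpha> - (dist x' y + \<delta>) powr \<alpha>\<bar> \<le> \<rho>" for x x' \<rho>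
    unfolding k_def using that by (intro abs_INF_diff_le False bdd) (simp add: u_def)
  have dist_diff: "\<bar>dist x y - dist x' y\<bar> \<le> dist x x'" for x x' y :: 'a
    by (metis abs_dist_diff_le dist_commute)
  have k1: "\<bar>k x - k x'\<bar> \<le> dist x x' powr \<alpha>" for x x'
  proof (rule k_le)
    fix y
    have "\<bar>(dist x y + \<delta>) powr \<alpha> - (dist x' y + \<delta>) powr \<alpha>\<bar> \<le> \<bar>dist x y - dist x' y\<bar> powr \<alpha>"
      using assms \<delta> by (intro shifted_powr_diff_le) auto
    also have "\<dots> \<le> dist x x' powr \<alpha>" using dist_diff assms by (intro powr_mono2) auto
    finally show "\<bar>(dist x y + \<delta>) powr \<alpha> - (dist x' y + \<delta>) powr \<alpha>\<bar> \<le> dist x x' powr \<alpha>" .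
  qed
  have k2: "\<bar>k x - k x'\<bar> \<le> \<delta> powr (\<alpha> - 1) * dist x x'" for x x'
  proof (rule k_le)
    fix y
    have "\<bar>(dist x y + \<delta>) powr \<alpha> - (dist x' y + \<delta>) powr \<alpha>\<bar>
        \<le> \<delta> powr (\<alpha> - 1) * \<bar>dist x y - dist x' y\<bar>"
      using assms \<delta> by (intro shifted_powr_diff_le) auto
    also have "\<dots> \<le> \<delta> powr (\<alpha> - 1) * dist x x'" using dist_diff by (intro mult_left_mono) auto
    finally show "\<bar>(dist x y + \<delta>) powr \<alpha> - (dist x' y + \<delta>) powr \<alpha>\<bar> \<le> \<delta> powr (\<alpha> - 1) * dist x x'" .
  qed
  have k_near: "f x \<le> k x" "k x \<le> f x + e / 4" if x: "x \<in> F" for x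
  proof -
    show "f x \<le> k x"
      unfolding k_def
    proof (rule cINF_greatest[OF False])
      fix y assume y: "y \<in> F"
      have "f x \<le> f y + dist x y powr \<alpha>" using f[OF x y] by linarith
      also have "\<dots> \<le> u x y"
        unfolding u_def using \<delta> assms by (intro add_left_mono powr_mono2) auto
      finally show "f x \<le> u x y" .
    qed
    have "k x \<le> u x x" unfolding k_def using bdd x by (rule cINF_lower)
    then show "k x \<le> f x + e / 4" using \<delta> by (simp add: u_def)
  qed
  define D where "D = diameter F"
  have D: "dist x y \<le> D" if "x \<in> F" "y \<in> F" for x y
    unfolding D_def using compact_imp_bounded[OF \<open>compact F\<close>] that by (rule diameter_bounded_bound)
  define M where "M = \<delta> powr (\<alpha> - 1) * D powr (1 - \<beta>) + 1"
  show thesis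
  proof (rule that[of "1 - \<eta>" M "\<lambda>x. (1 - \<eta>) * k x"])
    show "M > 0" unfolding M_def by (simp add: add_nonneg_pos)
    show "0 \<le> 1 - \<eta>" "1 - \<eta> < 1" using \<eta> by auto
    fix x assume x: "x \<in> F"
    have "\<bar>(1 - \<eta>) * k x - f x\<bar> = \<bar>(1 - \<eta>) * (k x - f x) - \<eta> * f x\<bar>"
      by (simp add: algebra_simps)
    also have "\<dots> \<le> \<bar>(1 - \<eta>) * (k x - f x)\<bar> + \<bar>\<eta> * f x\<bar>" by (rule abs_triangle_ineq4)
    also have "\<dots> \<le> 1 * (e / 4) + \<eta> * B"
      unfolding abs_mult using \<eta> k_near[OF x] B(2)[OF x] by (intro add_mono mult_mono) auto
    also have "\<dots> < e" using \<eta>(3) \<open>e > 0\<close> by linarith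
    finally show "\<bar>(1 - \<eta>) * k x - f x\<bar> < e" .
  next
    fix x y assume xy: "x \<in> F" "y \<in> F"
    have eq: "\<bar>(1 - \<eta>) * k x - (1 - \<eta>) * k y\<bar> = (1 - \<eta>) * \<bar>k x - k y\<bar>"
      using \<eta> by (simp add: right_diff_distrib[symmetric] abs_mult)
    show "\<bar>(1 - \<eta>) * k x - (1 - \<eta>) * k y\<bar> \<le> (1 - \<eta>) * dist x y powr \<alpha>"
      unfolding eq using \<eta> k1 by (intro mult_left_mono) auto
    have "(1 - \<eta>) * \<bar>k x - k y\<bar> \<le> 1 * \<bar>k x - k y\<bar>"
      using \<eta> by (intro mult_right_mono) auto
    also have "\<dots> \<le> \<delta> powr (\<alpha> - 1) * dist x y" using k2 by simp
    also have "dist x y = dist x y powr (1 - \<beta>) * dist x y powr \<beta>"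
      by (simp add: powr_add[symmetric])
    also have "\<delta> powr (\<alpha> - 1) * (dist x y powr (1 - \<beta>) * dist x y powr \<beta>)
        \<le> \<delta> powr (\<alpha> - 1) * (D powr (1 - \<beta>) * dist x y powr \<beta>)"
      using D[OF xy] assms by (intro mult_left_mono mult_right_mono powr_mono2) auto
    also have "\<dots> \<le> M * dist x y powr \<beta>"
      by (simp add: M_def distrib_right mult.assoc)
    finally show "\<bar>(1 - \<eta>) * k x - (1 - \<eta>) * k y\<bar> \<le> M * dist x y powr \<beta>"
      unfolding eq .
  qed
qed

text \<open>
  At distances up to \<open>\<delta>\<close>, where \<open>W * \<delta> powr (\<beta> - \<alpha>) = 1\<close>, both \<open>h\<close> and \<open>w\<close> are 1-Hoelder-\<open>\<alpha>\<close>, hence so is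
  the truncation. At larger distances the truncation differs from \<open>h\<close> by at most \<open>e\<close>, which the
  slack \<open>1 - \<theta>\<close> in the Hoelder constant of \<open>h\<close> absorbs. The bound \<open>e\<^sub>0\<close> depends on \<open>w\<close> only through \<open>W\<close>.
\<close>
lemma clamped_function_holder:
  fixes h :: "'a::metric_space \<Rightarrow> real"
  assumes "0 < \<alpha>" "\<alpha> < \<beta>" "0 \<le> \<theta>" "\<theta> < 1" "W > 0"
    and h: "\<And>x y. x \<in> F \<Longrightarrow> y \<in> F \<Longrightarrow> \<bar>h x - h y\<bar> \<le> \<theta> * dist x y powr \<alpha>"
  obtains e\<^sub>0 where "e\<^sub>0 > 0"
    "\<And>e w. 0 < e \<Longrightarrow> e \<le> e\<^sub>0 \<Longrightarrow> (\<And>x y. x \<in> F \<Longrightarrow> y \<in> F \<Longrightarrow> \<bar>w x - w y\<bar> \<le> W * dist x y powr \<beta>)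
       \<Longrightarrow> holder1_on \<alpha> F (\<lambda>x. max (h x - e) (min (h x + e) (w x)))"
proof -
  define \<delta> where "\<delta> = (1 / W) powr (1 / (\<beta> - \<alpha>))"
  have \<delta>: "\<delta> > 0" "W * \<delta> powr (\<beta> - \<alpha>) = 1"
    using assms by (auto simp: \<delta>_def powr_powr)
  define e\<^sub>0 where "e\<^sub>0 = (1 - \<theta>) * \<delta> powr \<alpha> / 2"
  show thesis
  proof (rule that)
    show "e\<^sub>0 > 0" using assms \<delta> by (simp add: e\<^sub>0_def)
    fix e and w :: "'a \<Rightarrow> real"
    assume e: "0 < e" "e \<le> e\<^sub>0"
      and w: "\<And>x y. x \<in> F \<Longrightarrow> y \<in> F \<Longrightarrow> \<bar>w x - w y\<bar> \<le> W * dist x y powr \<beta>"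
    define f where "f x = max (h x - e) (min (h x + e) (w x))" for x
    have "\<bar>f x - f y\<bar> \<le> dist x y powr \<alpha>" if xy: "x \<in> F" "y \<in> F" for x y
    proof (cases "dist x y \<le> \<delta>")
      case True
      have "\<theta> * dist x y powr \<alpha> \<le> 1 * dist x y powr \<alpha>"
        using assms by (intro mult_right_mono) auto
      then have hxy: "\<bar>h x - h y\<bar> \<le> dist x y powr \<alpha>" using h[OF xy] by linarith
      have "W * dist x y powr \<beta> = W * dist x y powr (\<beta> - \<alpha>) * dist x y powr \<alpha>"
        by (simp add: powr_add[symmetric])
      also have "\<dots> \<le> W * \<delta> powr (\<beta> - \<alpha>) * dist x y powr \<alpha>"
        using True assms by (intro mult_right_mono mult_left_mono powr_mono2) auto
      finally have "\<bar>w x - w y\<bar> \<le> dist x y powr \<alpha>" using w[OF xy] \<delta>(2) by simp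
      with hxy show ?thesis unfolding f_def max_def min_def by (auto simp: abs_le_iff)
    next
      case False
      then have "\<delta> powr \<alpha> \<le> dist x y powr \<alpha>" using \<delta> assms by (intro powr_mono2) auto
      then have "(1 - \<theta>) * \<delta> powr \<alpha> \<le> (1 - \<theta>) * dist x y powr \<alpha>"
        using assms by (intro mult_left_mono) auto
      then have "2 * e + \<theta> * dist x y powr \<alpha> \<le> dist x y powr \<alpha>"
        using e(2) by (simp add: e\<^sub>0_def algebra_simps)
      moreover have "\<bar>f z - h z\<bar> \<le> e" for z
        unfolding f_def using e(1) by (auto simp: max_def min_def abs_le_iff)
      ultimately show ?thesis
        using h[OF xy] \<open>\<bar>f x - h x\<bar> \<le> e\<close> \<open>\<bar>f y - h y\<bar> \<le> e\<close> by linarith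
    qed
    then show "holder1_on \<alpha> F (\<lambda>x. max (h x - e) (min (h x + e) (w x)))"
      unfolding holder1_on_def f_def by blast
  qed
qed

lemma soft_threshold_nonexpansive:
  fixes u v a \<tau> :: real
  shows "\<bar>(u - max (-\<tau>) (min \<tau> (u - a))) - (v - max (-\<tau>) (min \<tau> (v - a)))\<bar> \<le> \<bar>u - v\<bar>"
  by (auto simp: max_def min_def abs_if)

section \<open>Transfer from rougher to smoother functions\<close>

text \<open>
  An affine change of the range permutes the level sets and multiplies the measure of the set of
  levels by \<open>\<kappa>\<close>.
\<close>
lemma emeasure_large_levels_affine_pos:
  fixes h w :: "'a::metric_space \<Rightarrow> real"
  assumes "\<kappa> > 0" "\<And>x. x \<in> Q \<Longrightarrow> h x = \<kappa> * w x + b"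
    and "emeasure lebesgue (large_levels s c w Q) > 0"
  shows "emeasure lebesgue (large_levels s c h Q) > 0"
proof -
  have lev: "{x \<in> Q. h x = \<kappa> * r + b} = {x \<in> Q. w x = r}" for r
    using assms(1,2) by auto
  have "large_levels s c h Q = (\<lambda>r. \<kappa> *\<^sub>R r + b) ` large_levels s c w Q"
  proof (rule set_eqI)
    fix r
    have "r = \<kappa> * ((r - b) / \<kappa>) + b" using \<open>\<kappa> > 0\<close> by simp
    then have "r \<in> large_levels s c h Q \<longleftrightarrow> (r - b) / \<kappa> \<in> large_levels s c w Q"
      using lev[of "(r - b) / \<kappa>"] by (simp add: large_levels_def)
    also have "\<dots> \<longleftrightarrow> r \<in> (\<lambda>r. \<kappa> *\<^sub>R r + b) ` large_levels s c w Q"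
      using \<open>\<kappa> > 0\<close> by (force simp: image_iff)
    finally show "r \<in> large_levels s c h Q \<longleftrightarrow> r \<in> (\<lambda>r. \<kappa> *\<^sub>R r + b) ` large_levels s c w Q" .
  qed
  then have "emeasure lebesgue (large_levels s c h Q) = \<bar>\<kappa>\<bar> * emeasure lebesgue (large_levels s c w Q)"
    using emeasure_lebesgue_affine[of \<kappa> b "large_levels s c w Q"] by simp
  with assms(1,3) show ?thesis by (simp add: ennreal_zero_less_mult_iff)
qed

lemma holder_space_continuous_on:
  assumes "f \<in> mspace (holder_space \<alpha> F)" "\<alpha> > 0"
  shows "continuous_on F f"
  using assms by (intro holder_imp_continuous_on[of F f 1 \<alpha>]) (auto simp: holder_space_def holder1_on_def)

lemma restrict_in_holder_space:
  fixes F :: "'a::metric_space set"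
  assumes "compact F" "0 \<le> \<alpha>" "holder1_on \<alpha> F f"
  shows "restrict f F \<in> mspace (holder_space \<alpha> F)"
  using assms by (simp add: mspace_holder_space holder1_on_def)

text \<open>
  The functions with large levels in \<open>Q j\<close>, quantified by \<open>1 / Suc n\<close>, form closed sets which together
  cover \<open>G\<close>; one of them contains a ball.
\<close>
lemma generic_large_levels_locally_persistent:
  fixes F :: "'a::metric_space set"
  assumes F: "compact F" and \<alpha>: "0 < \<alpha>"
    and G: "G \<in> dense_gdeltas \<alpha> F" and s: "s > 0" "\<And>f. f \<in> G \<Longrightarrow> ennreal s < D_star_fun f F"
    and J: "finite J" "F = (\<Union>j\<in>J. Q j)" "\<And>j. j \<in> J \<Longrightarrow> compact (Q j)"
  obtains j c f e where "j \<in> J" "c > 0" "f \<in> mspace (holder_space \<alpha> F)" "e > 0"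
    "\<And>g. g \<in> mspace (holder_space \<alpha> F) \<Longrightarrow> (\<forall>x\<in>F. \<bar>g x - f x\<bar> < e)
       \<Longrightarrow> emeasure lebesgue (large_levels s c g (Q j)) > 0"
proof -
  let ?M = "mspace (holder_space \<alpha> F)"
  define K where "K p = {f. ennreal (1 / Suc (snd p)) \<le>
    emeasure lebesgue (large_levels s (1 / Suc (snd p)) f (Q (fst p)))}" for p :: "'b \<times> nat"
  have GM: "G \<subseteq> ?M"
    using G gdelta_in_subset by (fastforce simp: dense_gdeltas_def)
  have ne: "?M \<noteq> {}"
    using restrict_in_holder_space[OF F, of \<alpha> "\<lambda>_. 0"] \<alpha> by (force simp: holder1_on_def)
  have countable: "countable (J \<times> (UNIV :: nat set))"
    using J(1) by (intro countable_SIGMA) (auto simp: countable_finite)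
  have cover: "G \<subseteq> (\<Union>p\<in>J \<times> UNIV. K p)"
  proof
    fix f assume f: "f \<in> G"
    then have "continuous_on F f" using GM \<alpha> holder_space_continuous_on by blast
    from D_star_fun_gt_imp_large_levels[OF s(1) s(2)[OF f] J this]
    obtain j n where "j \<in> J" "f \<in> K (j, n)" unfolding K_def by auto
    then show "f \<in> (\<Union>p\<in>J \<times> UNIV. K p)" by blast
  qed
  have stable: "\<exists>e>0. \<forall>g\<in>?M. (\<forall>x\<in>F. \<bar>g x - f x\<bar> < e) \<longrightarrow> g \<notin> K p"
    if p: "p \<in> J \<times> UNIV" and f: "f \<in> ?M" "f \<notin> K p" for p f
  proof -
    obtain j n where jn: "p = (j, n)" "j \<in> J" using p by auto
    then have sub: "Q j \<subseteq> F" using J(2) by auto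
    have cont: "continuous_on (Q j) f"
      using holder_space_continuous_on[OF f(1) \<alpha>] sub by (rule continuous_on_subset)
    have small: "emeasure lebesgue (large_levels s (1 / Suc n) f (Q j)) < ennreal (1 / Suc n)"
      using f(2) by (simp add: K_def jn not_le)
    have "1 / real (Suc n) > 0" by simp
    obtain \<eta> where \<eta>: "\<eta> > 0" "\<And>g. (\<forall>x\<in>Q j. \<bar>g x - f x\<bar> < \<eta>) \<Longrightarrow>
        emeasure lebesgue (large_levels s (1 / Suc n) g (Q j)) < ennreal (1 / Suc n)"
      by (rule emeasure_large_levels_upper_semicontinuous
            [OF J(3)[OF jn(2)] cont \<open>1 / real (Suc n) > 0\<close> small]) (rule that)
    have "g \<notin> K p" if "\<forall>x\<in>F. \<bar>g x - f x\<bar> < \<eta>" for g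
      using \<eta>(2)[of g] that sub by (auto simp: K_def jn not_le)
    with \<eta>(1) show ?thesis by blast
  qed
  obtain p f e where p: "p \<in> J \<times> UNIV" "f \<in> ?M" "e > 0"
      "\<And>g. g \<in> ?M \<Longrightarrow> (\<forall>x\<in>F. \<bar>g x - f x\<bar> < e) \<Longrightarrow> g \<in> K p"
    by (rule dense_gdelta_holder_space_cover[OF G countable cover ne stable]) (assumption+, rule that)
  show thesis
  proof (rule that[of "fst p" "1 / Suc (snd p)" f e])
    fix g assume "g \<in> ?M" "\<forall>x\<in>F. \<bar>g x - f x\<bar> < e"
    then have "ennreal (1 / Suc (snd p)) \<le> emeasure lebesgue (large_levels s (1 / Suc (snd p)) g (Q (fst p)))"
      using p(4)[of g] by (simp add: K_def)
    moreover have "0 < ennreal (1 / Suc (snd p))" by simp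
    ultimately show "emeasure lebesgue (large_levels s (1 / Suc (snd p)) g (Q (fst p))) > 0"
      by (rule less_le_trans[rotated])
  qed (use p in auto)
qed

text \<open>
  The perturbation \<open>g'\<close> of \<open>g\<close> is, on \<open>Q j\<close>, a constant plus a small multiple of a function \<open>f\<^sub>1\<close> from
  the ball of rough functions with large levels. The scaling by \<open>\<kappa>\<close> reconciles the possibly large
  Hoelder-\<open>\<beta>\<close> constant of \<open>f\<^sub>1\<close> with the bound 1.
\<close>
lemma smoother_functions_locally_good:
  fixes F :: "'a::metric_space set"
  assumes F: "compact F" and \<alpha>: "0 < \<alpha>" "\<alpha> < \<beta>" "\<beta> \<le> 1"
    and G: "G \<in> dense_gdeltas \<alpha> F" and s: "s > 0" "\<And>f. f \<in> G \<Longrightarrow> ennreal s < D_star_fun f F"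
    and g: "g \<in> mspace (holder_space \<beta> F)" and "\<epsilon> > 0"
  obtains g' \<eta> where "g' \<in> mspace (holder_space \<beta> F)" "\<forall>x\<in>F. \<bar>g' x - g x\<bar> < \<epsilon>" "\<eta> > 0"
    "\<And>h. h \<in> mspace (holder_space \<beta> F) \<Longrightarrow> (\<forall>x\<in>F. \<bar>h x - g' x\<bar> < \<eta>) \<Longrightarrow> ennreal s \<le> D_star_fun h F"
proof -
  have \<beta>: "\<beta> > 0" using \<alpha> by simp
  have cont_g: "continuous_on F g" using g \<beta> by (rule holder_space_continuous_on)
  have holder_g: "\<bar>g x - g y\<bar> \<le> dist x y powr \<beta>" if "x \<in> F" "y \<in> F" for x y
    using g that by (auto simp: holder_space_def holder1_on_def)
  have compact_g: "compact (g ` F)" using cont_g F by (rule compact_continuous_image)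
  then have "bounded (g ` F)" by (rule compact_imp_bounded)
  then obtain B where B: "B > 0" "\<And>x. x \<in> F \<Longrightarrow> \<bar>g x\<bar> \<le> B"
    unfolding bounded_pos by auto
  define \<tau> where "\<tau> = \<epsilon> / 4"
  have \<tau>: "\<tau> > 0" using \<open>\<epsilon> > 0\<close> by (simp add: \<tau>_def)
  obtain J where J: "finite J" "g ` F \<subseteq> (\<Union>j\<in>J. ball j \<tau>)"
    using compact_g[unfolded compact_eq_totally_bounded, THEN conjunct2, rule_format, OF \<tau>] by auto
  define Q where "Q j = {x \<in> F. \<bar>g x - j\<bar> \<le> \<tau>}" for j
  have cover: "F = (\<Union>j\<in>J. Q j)"
  proof (intro equalityI subsetI)
    fix x assume x: "x \<in> F"
    then have "g x \<in> (\<Union>j\<in>J. ball j \<tau>)" using J(2) by blast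
    then obtain j where "j \<in> J" "\<bar>g x - j\<bar> < \<tau>" by (auto simp: dist_real_def abs_minus_commute)
    with x show "x \<in> (\<Union>j\<in>J. Q j)" by (auto simp: Q_def intro!: bexI[of _ j])
  qed (auto simp: Q_def)
  have compact_Q: "compact (Q j)" for j
  proof -
    have "closed (F \<inter> g -` {j - \<tau>..j + \<tau>})"
      using cont_g F by (intro continuous_closed_preimage) (auto simp: compact_imp_closed)
    moreover have "F \<inter> (F \<inter> g -` {j - \<tau>..j + \<tau>}) = Q j"
      by (auto simp: Q_def abs_le_iff)
    ultimately show ?thesis using compact_Int_closed[OF F] by metis
  qed
  obtain j c f\<^sub>0 e\<^sub>0 where j: "j \<in> J" "c > 0" "f\<^sub>0 \<in> mspace (holder_space \<alpha> F)" "e\<^sub>0 > 0"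
    and good: "\<And>f. f \<in> mspace (holder_space \<alpha> F) \<Longrightarrow> (\<forall>x\<in>F. \<bar>f x - f\<^sub>0 x\<bar> < e\<^sub>0)
       \<Longrightarrow> emeasure lebesgue (large_levels s c f (Q j)) > 0"
    by (rule generic_large_levels_locally_persistent[OF F \<alpha>(1) G s J(1) cover compact_Q]) (assumption, rule that)
  have QF: "Q j \<subseteq> F" by (auto simp: Q_def)
  have f\<^sub>0: "holder1_on \<alpha> F f\<^sub>0" using j(3) by (simp add: holder_space_def)
  have "\<alpha> \<le> 1" "e\<^sub>0 / 2 > 0" using \<alpha> j(4) by auto
  obtain f\<^sub>1 \<theta> M where \<theta>: "0 \<le> \<theta>" "\<theta> < 1" "M > 0" and f\<^sub>1: "\<And>x. x \<in> F \<Longrightarrow> \<bar>f\<^sub>1 x - f\<^sub>0 x\<bar> < e\<^sub>0 / 2"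
    and f\<^sub>1\<alpha>: "\<And>x y. x \<in> F \<Longrightarrow> y \<in> F \<Longrightarrow> \<bar>f\<^sub>1 x - f\<^sub>1 y\<bar> \<le> \<theta> * dist x y powr \<alpha>"
    and f\<^sub>1\<beta>: "\<And>x y. x \<in> F \<Longrightarrow> y \<in> F \<Longrightarrow> \<bar>f\<^sub>1 x - f\<^sub>1 y\<bar> \<le> M * dist x y powr \<beta>"
    by (rule holder_function_approximation[OF F \<alpha>(1) \<open>\<alpha> \<le> 1\<close> \<beta> \<alpha>(3) f\<^sub>0 \<open>e\<^sub>0 / 2 > 0\<close>]) (rule that)
  have "continuous_on F f\<^sub>1" using f\<^sub>1\<beta> \<beta> by (rule holder_imp_continuous_on)
  then have "bounded (f\<^sub>1 ` F)" using F by (simp add: compact_continuous_image compact_imp_bounded)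
  then obtain B\<^sub>1 where B\<^sub>1: "B\<^sub>1 > 0" "\<And>x. x \<in> F \<Longrightarrow> \<bar>f\<^sub>1 x\<bar> \<le> B\<^sub>1"
    unfolding bounded_pos by auto
  \<comment> \<open>The shrinking factor \<open>1 - \<eta>\<close> makes room in the Hoelder constant for the summand \<open>\<kappa> f\<^sub>1\<close>.\<close>
  define \<eta> where "\<eta> = min 1 (\<epsilon> / (4 * (B + \<tau>)))"
  have "\<eta> * (B + \<tau>) \<le> \<epsilon> / (4 * (B + \<tau>)) * (B + \<tau>)"
    using B(1) \<tau> by (intro mult_right_mono) (auto simp: \<eta>_def)
  also have "\<dots> = \<epsilon> / 4"
    using nonzero_mult_divide_mult_cancel_right[of "B + \<tau>" \<epsilon> 4] B(1) \<tau> by simp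
  finally have \<eta>: "\<eta> * (B + \<tau>) \<le> \<epsilon> / 4" "0 < \<eta>" "\<eta> \<le> 1"
    using B(1) \<tau> \<open>\<epsilon> > 0\<close> by (simp_all add: \<eta>_def)
  define \<kappa> where "\<kappa> = min (\<eta> / M) (\<epsilon> / (8 * B\<^sub>1))"
  have "\<kappa> * M \<le> \<eta> / M * M" "\<kappa> * B\<^sub>1 \<le> \<epsilon> / (8 * B\<^sub>1) * B\<^sub>1"
    using \<theta>(3) B\<^sub>1(1) by (intro mult_right_mono; simp add: \<kappa>_def)+
  then have \<kappa>: "\<kappa> > 0" "\<kappa> * M \<le> \<eta>" "\<kappa> * B\<^sub>1 \<le> \<epsilon> / 8"
    using \<theta>(3) B\<^sub>1(1) \<eta>(2) \<open>\<epsilon> > 0\<close> by (auto simp: \<kappa>_def)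
  \<comment> \<open>Soft thresholding around the level \<open>j\<close> flattens \<open>g\<close> on \<open>Q j\<close> at a cost of at most \<open>\<tau>\<close>.\<close>
  define g\<^sub>1 where "g\<^sub>1 x = g x - max (-\<tau>) (min \<tau> (g x - j))" for x
  have g\<^sub>1_near: "\<bar>g\<^sub>1 x - g x\<bar> \<le> \<tau>" for x
    unfolding g\<^sub>1_def using \<tau> by (auto simp: max_def min_def)
  have g\<^sub>1_holder: "\<bar>g\<^sub>1 x - g\<^sub>1 y\<bar> \<le> dist x y powr \<beta>" if "x \<in> F" "y \<in> F" for x y
    unfolding g\<^sub>1_def using soft_threshold_nonexpansive holder_g[OF that] by (rule order_trans)
  have g\<^sub>1_flat: "g\<^sub>1 x = j" if "x \<in> Q j" for x
    using that unfolding g\<^sub>1_def Q_def by (auto simp: max_def min_def abs_le_iff)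
  define g' where "g' = (\<lambda>x. (1 - \<eta>) * g\<^sub>1 x + \<kappa> * f\<^sub>1 x)"
  have g'_holder: "holder1_on \<beta> F g'"
    unfolding holder1_on_def
  proof (intro ballI)
    fix x y assume xy: "x \<in> F" "y \<in> F"
    have "\<bar>g' x - g' y\<bar> = \<bar>(1 - \<eta>) * (g\<^sub>1 x - g\<^sub>1 y) + \<kappa> * (f\<^sub>1 x - f\<^sub>1 y)\<bar>"
      by (simp add: g'_def algebra_simps)
    also have "\<dots> \<le> (1 - \<eta>) * \<bar>g\<^sub>1 x - g\<^sub>1 y\<bar> + \<kappa> * \<bar>f\<^sub>1 x - f\<^sub>1 y\<bar>"
      using abs_triangle_ineq[of "(1 - \<eta>) * (g\<^sub>1 x - g\<^sub>1 y)" "\<kappa> * (f\<^sub>1 x - f\<^sub>1 y)"] \<eta> \<kappa> by (simp add: abs_mult)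
    also have "\<dots> \<le> (1 - \<eta>) * dist x y powr \<beta> + \<kappa> * (M * dist x y powr \<beta>)"
      using g\<^sub>1_holder[OF xy] f\<^sub>1\<beta>[OF xy] \<eta> \<kappa> by (intro add_mono mult_left_mono) auto
    also have "\<dots> = (1 - \<eta> + \<kappa> * M) * dist x y powr \<beta>" by (simp add: algebra_simps)
    also have "\<dots> \<le> 1 * dist x y powr \<beta>" using \<kappa> by (intro mult_right_mono) auto
    finally show "\<bar>g' x - g' y\<bar> \<le> dist x y powr \<beta>" by simp
  qed
  have g'_near: "\<bar>g' x - g x\<bar> < \<epsilon>" if x: "x \<in> F" for x
  proof -
    have "\<bar>g\<^sub>1 x\<bar> \<le> B + \<tau>" using g\<^sub>1_near[of x] B(2)[OF x] by linarith
    then have "\<eta> * \<bar>g\<^sub>1 x\<bar> \<le> \<eta> * (B + \<tau>)"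
      using \<eta>(2) by (intro mult_left_mono) auto
    also note \<eta>(1)
    finally have 1: "\<bar>\<eta> * g\<^sub>1 x\<bar> \<le> \<epsilon> / 4"
      using \<eta>(2) by (simp add: abs_mult)
    have "\<kappa> * \<bar>f\<^sub>1 x\<bar> \<le> \<kappa> * B\<^sub>1"
      using \<kappa>(1) B\<^sub>1(2)[OF x] by (intro mult_left_mono) auto
    also note \<kappa>(3)
    finally have 2: "\<bar>\<kappa> * f\<^sub>1 x\<bar> \<le> \<epsilon> / 8"
      using \<kappa>(1) by (simp add: abs_mult)
    have "g' x - g x = (g\<^sub>1 x - g x) - \<eta> * g\<^sub>1 x + \<kappa> * f\<^sub>1 x"
      by (simp add: g'_def algebra_simps)
    with 1 2 g\<^sub>1_near[of x] \<open>\<epsilon> > 0\<close> show ?thesis unfolding \<tau>_def by linarith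
  qed
  have "1 / \<kappa> > 0" using \<kappa>(1) by simp
  obtain e\<^sub>1 where e\<^sub>1: "e\<^sub>1 > 0" and clamp: "\<And>e w. 0 < e \<Longrightarrow> e \<le> e\<^sub>1 \<Longrightarrow>
      (\<And>x y. x \<in> F \<Longrightarrow> y \<in> F \<Longrightarrow> \<bar>w x - w y\<bar> \<le> 1 / \<kappa> * dist x y powr \<beta>)
       \<Longrightarrow> holder1_on \<alpha> F (\<lambda>x. max (f\<^sub>1 x - e) (min (f\<^sub>1 x + e) (w x)))"
    by (rule clamped_function_holder[OF \<alpha>(1,2) \<theta>(1,2) \<open>1 / \<kappa> > 0\<close> f\<^sub>1\<alpha>]) (assumption+, blast intro: that)
  define e where "e = min e\<^sub>1 (e\<^sub>0 / 2)"
  have e: "e > 0" "e \<le> e\<^sub>1" "e \<le> e\<^sub>0 / 2" using e\<^sub>1 j(4) by (auto simp: e_def)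
  show thesis
  proof (rule that[of "restrict g' F" "\<kappa> * e"])
    show "restrict g' F \<in> mspace (holder_space \<beta> F)"
      using F \<beta> g'_holder by (intro restrict_in_holder_space) auto
    show "\<forall>x\<in>F. \<bar>restrict g' F x - g x\<bar> < \<epsilon>" using g'_near by simp
    show "\<kappa> * e > 0" using \<kappa> e by simp
    fix h assume h: "h \<in> mspace (holder_space \<beta> F)" "\<forall>x\<in>F. \<bar>h x - restrict g' F x\<bar> < \<kappa> * e"
    \<comment> \<open>Undo the affine change that turns \<open>f\<^sub>1\<close> into \<open>g'\<close> on \<open>Q j\<close>.\<close>
    define b where "b = (1 - \<eta>) * j"
    define w where "w x = (h x - b) / \<kappa>" for x
    define f where "f x = max (f\<^sub>1 x - e) (min (f\<^sub>1 x + e) (w x))" for x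
    have "\<bar>w x - w y\<bar> \<le> 1 / \<kappa> * dist x y powr \<beta>" if "x \<in> F" "y \<in> F" for x y
    proof -
      have "\<bar>w x - w y\<bar> = \<bar>h x - h y\<bar> / \<kappa>"
        using \<kappa> by (simp add: w_def diff_divide_distrib[symmetric])
      also have "\<dots> \<le> dist x y powr \<beta> / \<kappa>"
        using h(1) that \<kappa> by (intro divide_right_mono) (auto simp: holder_space_def holder1_on_def)
      finally show ?thesis by simp
    qed
    then have "holder1_on \<alpha> F f"
      using clamp[OF e(1,2), of w] unfolding f_def by blast
    then have fM: "restrict f F \<in> mspace (holder_space \<alpha> F)"
      using F \<alpha> by (intro restrict_in_holder_space) auto
    have "\<bar>restrict f F x - f\<^sub>0 x\<bar> < e\<^sub>0" if "x \<in> F" for x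
    proof -
      have "\<bar>f x - f\<^sub>1 x\<bar> \<le> e"
        unfolding f_def using e(1) by (auto simp: max_def min_def abs_le_iff)
      with f\<^sub>1[OF that] e(3) have "\<bar>f x - f\<^sub>0 x\<bar> < e\<^sub>0" by linarith
      with that show ?thesis by simp
    qed
    then have pos: "emeasure lebesgue (large_levels s c (restrict f F) (Q j)) > 0"
      using good[OF fM] by blast
    have "restrict f F x = w x" if "x \<in> Q j" for x
    proof -
      have x: "x \<in> F" using that QF by auto
      have "\<kappa> * w x = h x - b" using \<kappa>(1) by (simp add: w_def)
      then have "\<kappa> * (w x - f\<^sub>1 x) = h x - g' x"
        using g\<^sub>1_flat[OF that] by (simp add: g'_def b_def right_diff_distrib)
      then have "\<kappa> * \<bar>w x - f\<^sub>1 x\<bar> = \<bar>h x - g' x\<bar>"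
        using \<kappa>(1) by (metis abs_mult abs_of_pos)
      then have "\<kappa> * \<bar>w x - f\<^sub>1 x\<bar> < \<kappa> * e" using h(2) x by simp
      then have "\<bar>w x - f\<^sub>1 x\<bar> < e" using \<kappa>(1) by simp
      with x show ?thesis unfolding f_def by (simp add: max_def min_def abs_less_iff)
    qed
    then have "h x = \<kappa> * restrict f F x + b" if "x \<in> Q j" for x
      using that \<kappa>(1) by (simp only: w_def) simp
    then have "emeasure lebesgue (large_levels s c h (Q j)) > 0"
      using \<kappa>(1) pos by (intro emeasure_large_levels_affine_pos[of \<kappa> "Q j" h "restrict f F" b])
    then show "ennreal s \<le> D_star_fun h F"
      using holder_space_continuous_on[OF h(1) \<beta>] by (intro D_star_fun_ge[OF F _ QF j(2)])
  qed
qed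

text \<open>
  The functions around which all members of a small ball satisfy the bound form an open set by
  construction; it is dense by the preceding lemma.
\<close>
lemma D_star_mono:
  fixes F :: "'a::metric_space set"
  assumes F: "compact F" and \<alpha>: "0 < \<alpha>" "\<alpha> < \<beta>" "\<beta> \<le> 1"
  shows "D_star \<alpha> F \<le> D_star \<beta> F"
proof (rule ccontr)
  assume "\<not> ?thesis"
  then obtain y where y: "D_star \<beta> F < y" "y < D_star \<alpha> F"
    using dense by (auto simp: not_le)
  then obtain s where s: "y = ennreal s" "s \<ge> 0"
    by (metis ennreal_cases top.extremum_strict)
  have "s > 0"
    using y(1) s by (cases "s = 0") auto
  obtain G where G: "G \<in> dense_gdeltas \<alpha> F" "ennreal s < (INF f\<in>G. D_star_fun f F)"
    using y(2) unfolding s(1) D_star_def less_SUP_iff by blast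
  have G_gt: "ennreal s < D_star_fun f F" if "f \<in> G" for f
    using G(2) that by (meson INF_lower less_le_trans)
  let ?M = "mspace (holder_space \<beta> F)"
  define U where "U = {g \<in> ?M. \<exists>\<eta>>0. \<forall>h\<in>?M. (\<forall>x\<in>F. \<bar>h x - g x\<bar> < \<eta>) \<longrightarrow> ennreal s \<le> D_star_fun h F}"
  have "U \<in> dense_gdeltas \<beta> F"
  proof (rule open_dense_in_dense_gdeltas)
    show "openin (mtopology_of (holder_space \<beta> F)) U"
      unfolding openin_holder_space
    proof (intro conjI ballI)
      show "U \<subseteq> ?M" by (auto simp: U_def)
      fix f assume "f \<in> U"
      then obtain \<eta> where \<eta>: "\<eta> > 0"
          "\<And>h. h \<in> ?M \<Longrightarrow> (\<forall>x\<in>F. \<bar>h x - f x\<bar> < \<eta>) \<Longrightarrow> ennreal s \<le> D_star_fun h F"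
        by (auto simp: U_def)
      have "g \<in> U" if g: "g \<in> ?M" "\<forall>x\<in>F. \<bar>g x - f x\<bar> < \<eta> / 2" for g
      proof -
        have "ennreal s \<le> D_star_fun h F" if h: "h \<in> ?M" "\<forall>x\<in>F. \<bar>h x - g x\<bar> < \<eta> / 2" for h
        proof (rule \<eta>(2)[OF h(1)], rule ballI)
          fix x assume "x \<in> F"
          with g(2) h(2) have "\<bar>g x - f x\<bar> < \<eta> / 2" "\<bar>h x - g x\<bar> < \<eta> / 2" by auto
          then show "\<bar>h x - f x\<bar> < \<eta>" by linarith
        qed
        with g(1) \<eta>(1) show ?thesis
          unfolding U_def by (auto intro!: exI[of _ "\<eta> / 2"])
      qed
      with \<eta>(1) show "\<exists>e>0. \<forall>g\<in>?M. (\<forall>x\<in>F. \<bar>g x - f x\<bar> < e) \<longrightarrow> g \<in> U"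
        by (intro exI[of _ "\<eta> / 2"]) auto
    qed
    fix f and e :: real assume "f \<in> ?M" "e > 0"
    obtain g' \<eta> where "g' \<in> ?M" "\<forall>x\<in>F. \<bar>g' x - f x\<bar> < e" "\<eta> > 0"
      "\<And>h. h \<in> ?M \<Longrightarrow> (\<forall>x\<in>F. \<bar>h x - g' x\<bar> < \<eta>) \<Longrightarrow> ennreal s \<le> D_star_fun h F"
      by (rule smoother_functions_locally_good[OF F \<alpha> G(1) \<open>s > 0\<close> G_gt \<open>f \<in> ?M\<close> \<open>e > 0\<close>])
        (assumption, rule that)
    then show "\<exists>g\<in>U. \<forall>x\<in>F. \<bar>g x - f x\<bar> < e"
      unfolding U_def by blast
  qed
  moreover have "ennreal s \<le> (INF f\<in>U. D_star_fun f F)"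
  proof (rule INF_greatest)
    fix g assume "g \<in> U"
    then obtain \<eta> where "g \<in> ?M" "\<eta> > 0"
        "\<forall>h\<in>?M. (\<forall>x\<in>F. \<bar>h x - g x\<bar> < \<eta>) \<longrightarrow> ennreal s \<le> D_star_fun h F"
      unfolding U_def by blast
    then show "ennreal s \<le> D_star_fun g F" by simp
  qed
  ultimately have "ennreal s \<le> D_star \<beta> F"
    unfolding D_star_def by (rule SUP_upper2)
  with y(1) s(1) show False by simp
qed

theorem theorem3p4:
  fixes F :: "(real ^ 'p) set"
  assumes "compact F"
  shows "mono_on {0<..1} (\<lambda>\<alpha>. D_star \<alpha> F)"
proof (rule mono_onI)
  fix \<alpha> \<beta> :: real
  assume "\<alpha> \<in> {0<..1}" "\<beta> \<in> {0<..1}" "\<alpha> \<le> \<beta>"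
  then show "D_star \<alpha> F \<le> D_star \<beta> F"
    using D_star_mono[OF assms, of \<alpha> \<beta>] by (cases "\<alpha> = \<beta>") auto
qed

end
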